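(* Let $n \geq 1$ be an integer and let $K \in C(\mathbb{R}^{2n})$, $K\not\equiv 0$, have constant sign at infinity and satisfy $$|K(x)| \leq C(|x|^\lambda + 1) \quad \text{in } \mathbb{R}^{2n}, \quad \text{for some } C > 0,\ \lambda \geq 0.$$ Then any normal solution $u$ of $$(-\Delta)^n u = K(x)e^{2nu} \quad \text{in } \mathbb{R}^{2n}$$ satisfies $$\Lambda_u \geq - \alpha_1(K)\gamma_n, \quad\text{where}\quad \alpha_1(K) := \sup\left\{\beta \in \mathbb{R} \;:\; K(x)(1+ |x|)^{2n\beta} \in L^1(\mathbb{R}^{2n}) \right\}.$$ Hence, if such a $K \not\equiv 0$ is moreover nonpositive, a necessary condition for the existence of a normal solution (equivalently, of a normal conformal metric $g_u=e^{2u}|dx|^2$ in $\mathbb{R}^{2n}$ with $Q$-curvature $K$) is $\alpha_1(K) \geq 0$.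
   Context: $\gamma_n := \frac{(2n-1)!}{2}|S^{2n}| = 2^{2n-1}(n-1)!\,\pi^n$. A normal solution is a solution $u$ of the equation with $u(x) = O(\ln|x|)$ as $|x|\to\infty$. For such $u$ (under the hypotheses on $K$) one has $Ke^{2nu}\in L^1(\mathbb{R}^{2n})$ and the total curvature is $\Lambda_u := \int_{\mathbb{R}^{2n}} K e^{2nu}\,dx$. The value $\alpha_1(K)=+\infty$ is allowed. "Constant sign at infinity" means that there is $R>0$ such that $K\ge 0$ on $\{|x|\ge R\}$ or $K\le 0$ on $\{|x|\ge R\}$. A solution is a continuous function satisfying the equation in the sense of distributions. *)

theory Defs
  imports "HOL-Analysis.Analysis" "HOL-Library.Landau_Symbols"
begin

definition partial_deriv :: "'a::euclidean_space \<Rightarrow> ('a \<Rightarrow> real) \<Rightarrow> 'a \<Rightarrow> real" where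
  "partial_deriv b f x = frechet_derivative f (at x) b"

definition neg_laplacian :: "('a::euclidean_space \<Rightarrow> real) \<Rightarrow> 'a \<Rightarrow> real" where
  "neg_laplacian f x = - (\<Sum>b\<in>Basis. partial_deriv b (partial_deriv b f) x)"

text \<open>\<open>C\<^sup>\<infinity>\<close>: every iterated partial derivative is (totally) differentiable; in particular
  all of them are continuous.\<close>

definition C_infinity :: "('a::euclidean_space \<Rightarrow> real) \<Rightarrow> bool" where
  "C_infinity f \<longleftrightarrow> (\<forall>bs\<in>lists Basis. foldr partial_deriv bs f differentiable_on UNIV)"

definition test_function :: "('a::euclidean_space \<Rightarrow> real) \<Rightarrow> bool" where
  "test_function \<phi> \<longleftrightarrow> C_infinity \<phi> \<and> compact (closure {x. \<phi> x \<noteq> 0})"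

text \<open>\<open>(-\<Delta>)\<^sup>n u = K exp(2nu)\<close> in the sense of distributions. For continuous \<open>K\<close> both integrands
  are continuous with compact support, so the integrals are genuine.\<close>

definition Q_solution ::
    "nat \<Rightarrow> ('a::euclidean_space \<Rightarrow> real) \<Rightarrow> ('a \<Rightarrow> real) \<Rightarrow> bool" where
  "Q_solution n K u \<longleftrightarrow> continuous_on UNIV u \<and>
     (\<forall>\<phi>. test_function \<phi> \<longrightarrow>
        (\<integral>x. u x * (neg_laplacian ^^ n) \<phi> x \<partial>lborel)
          = (\<integral>x. K x * exp (2 * real n * u x) * \<phi> x \<partial>lborel))"

definition log_growth :: "('a::euclidean_space \<Rightarrow> real) \<Rightarrow> bool" where
  "log_growth u \<longleftrightarrow> u \<in> O[at_infinity](\<lambda>x. ln (norm x))"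

definition normal_solution ::
    "nat \<Rightarrow> ('a::euclidean_space \<Rightarrow> real) \<Rightarrow> ('a \<Rightarrow> real) \<Rightarrow> bool" where
  "normal_solution n K u \<longleftrightarrow> Q_solution n K u \<and> log_growth u"

text \<open>A Riemannian metric is a field of bilinear forms; \<open>conformal_metric u\<close> is
  \<open>exp(2u) |dx|\<^sup>2\<close>. By the transformation law of the \<open>Q\<close>-curvature under conformal changes of the
  flat metric, it has \<open>Q\<close>-curvature \<open>K\<close> iff \<open>(-\<Delta>)\<^sup>n u = K exp(2nu)\<close>; this is taken as the
  definition, since \<open>u\<close> is only assumed continuous.\<close>

definition conformal_metric :: "('a::euclidean_space \<Rightarrow> real) \<Rightarrow> 'a \<Rightarrow> 'a \<Rightarrow> 'a \<Rightarrow> real" where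
  "conformal_metric u x v w = exp (2 * u x) * (v \<bullet> w)"

definition has_Q_curvature ::
    "nat \<Rightarrow> ('a::euclidean_space \<Rightarrow> 'a \<Rightarrow> 'a \<Rightarrow> real) \<Rightarrow> ('a \<Rightarrow> real) \<Rightarrow> bool" where
  "has_Q_curvature n g K \<longleftrightarrow> (\<exists>u. g = conformal_metric u \<and> Q_solution n K u)"

definition normal_conformal_metric :: "('a::euclidean_space \<Rightarrow> 'a \<Rightarrow> 'a \<Rightarrow> real) \<Rightarrow> bool" where
  "normal_conformal_metric g \<longleftrightarrow>
     (\<exists>u. g = conformal_metric u \<and> continuous_on UNIV u \<and> log_growth u)"

definition total_curvature ::
    "nat \<Rightarrow> ('a::euclidean_space \<Rightarrow> real) \<Rightarrow> ('a \<Rightarrow> real) \<Rightarrow> real" where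
  "total_curvature n K u = (\<integral>x. K x * exp (2 * real n * u x) \<partial>lborel)"

text \<open>Taken in the extended reals, as the supremum may be \<open>+\<infinity>\<close>.\<close>

definition alpha1 :: "nat \<Rightarrow> ('a::euclidean_space \<Rightarrow> real) \<Rightarrow> ereal" where
  "alpha1 n K =
     Sup (ereal ` {\<beta>. integrable lborel (\<lambda>x. K x * (1 + norm x) powr (2 * real n * \<beta>))})"

definition constant_sign_at_infinity :: "('a::euclidean_space \<Rightarrow> real) \<Rightarrow> bool" where
  "constant_sign_at_infinity K \<longleftrightarrow>
     (\<exists>R>0. (\<forall>x. norm x \<ge> R \<longrightarrow> K x \<ge> 0) \<or> (\<forall>x. norm x \<ge> R \<longrightarrow> K x \<le> 0))"

text \<open>The area of the unit sphere \<open>S\<^sup>d\<close> in \<open>\<real>\<^bsup>d+1\<^esup>\<close> is \<open>d + 1\<close> times the volume of the unit ball.\<close>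

definition unit_sphere_area :: "nat \<Rightarrow> real" where
  "unit_sphere_area d = real (d + 1) * unit_ball_vol (real (d + 1))"

definition gamma_n :: "nat \<Rightarrow> real" where
  "gamma_n n = fact (2 * n - 1) / 2 * unit_sphere_area (2 * n)"

lemma gamma_n_closed_form:
  assumes "n \<ge> 1"
  shows "gamma_n n = 2 ^ (2 * n - 1) * fact (n - 1) * pi ^ n"
proof -
  obtain m where m: "n = Suc m" using assms by (cases n) auto
  define F a b d :: real
    where "F = fact (2 * m + 1)" and "a = m + 2" and "b = m + 1" and "d = 2 * m + 3"
  have pos: "F > 0" "a > 0" "b > 0" "d > 0"
    by (simp_all add: F_def a_def b_def d_def)
  have "2 * Suc n = Suc (Suc (Suc (2 * m + 1)))" using m by simp
  then have big: "(fact (2 * Suc n) :: real) = 2 * a * d * (2 * b) * F"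
    unfolding F_def a_def b_def d_def by (simp only: fact_Suc) (simp add: algebra_simps)
  have small: "(fact (Suc n) :: real) = a * b * fact m"
    using m by (simp add: a_def b_def algebra_simps)
  have "gamma_n n = F / 2 * (d * (2 ^ (2 * Suc n) * (a * b * fact m) /
          (2 * a * d * (2 * b) * F) * pi ^ n))"
    unfolding gamma_n_def unit_sphere_area_def unit_ball_vol_odd big small
    using m by (simp add: F_def d_def add.commute)
  also have "\<dots> = 2 ^ (2 * Suc n) / 8 * fact m * pi ^ n"
    using pos by (simp add: field_simps)
  also have "\<dots> = 2 ^ (2 * n - 1) * fact (n - 1) * pi ^ n"
    using m by simp
  finally show ?thesis .
qed

end

theory Submission
  imports Defs
begin

text \<open>Write \<open>f = K exp(2nu)\<close> and test the equation with the compactly supported bumps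
  \<open>y \<mapsto> \<omega>(|y - x|\<^sup>2 / s)\<close>, \<open>\<omega>(0) = 1\<close>. For a suitable radial kernel \<open>\<theta>\<close> of total mass \<open>2 \<gamma>\<^sub>n\<close>,
  the means \<open>W(x, s) = s\<^sup>-\<^sup>n \<integral> u(y) \<theta>(|y - x|\<^sup>2 / s) dy\<close> satisfy \<open>\<partial>\<^sub>s W(x, s) = - F(x, s) / s\<close> with
  \<open>F(x, s) = \<integral> f(y) \<omega>(|y - x|\<^sup>2 / s) dy\<close>; they tend to \<open>2 \<gamma>\<^sub>n u(x)\<close> as \<open>s \<rightarrow> 0\<close>, and
  \<open>W(x, s) - W(0, s) \<rightarrow> 0\<close> as \<open>s \<rightarrow> \<infinity>\<close> by the logarithmic growth of \<open>u\<close>. So integrating in \<open>s\<close> replaces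
  the logarithmic potential representation of \<open>u\<close>.

  Since \<open>W(0, s) = O(ln s)\<close> while \<open>F(0, s)\<close> dominates the mass of \<open>|f|\<close> on large balls up to a
  constant, \<open>f\<close> is integrable. Then \<open>F(0, s) \<rightarrow> \<Lambda>\<close>, and comparing \<open>W(x, \<cdot>)\<close> with \<open>W(0, \<cdot>)\<close> at
  \<open>s = |x|\<^sup>2\<close> gives \<open>u(x) \<ge> - (\<Lambda> / \<gamma>\<^sub>n + \<epsilon>) ln |x| - C\<close>; very small scales are harmless because \<open>f\<close>
  grows at most polynomially. Hence \<open>|K| (1 + |x|)\<^bsup>2n\<beta>\<^esup> \<le> C |f|\<close> for every \<open>\<beta> < - \<Lambda> / \<gamma>\<^sub>n\<close>.\<close>

subsection \<open>Smooth functions of one variable\<close>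

text \<open>\<open>deriv\<close> is a total operator, so differentiability has to be demanded
  explicitly: each iterate must really be differentiable with the next iterate as its
  derivative.\<close>

definition smooth1 :: "(real \<Rightarrow> real) \<Rightarrow> bool" where
  "smooth1 g \<longleftrightarrow> (\<forall>k t. ((deriv ^^ k) g has_real_derivative (deriv ^^ Suc k) g t) (at t))"

lemma smooth1D: "smooth1 g \<Longrightarrow> ((deriv ^^ k) g has_real_derivative (deriv ^^ Suc k) g t) (at t)"
  by (simp add: smooth1_def)

lemma smooth1_DERIV:
  assumes "smooth1 g"
  shows "(g has_real_derivative deriv g t) (at t)"
    and "(deriv g has_real_derivative deriv (deriv g) t) (at t)"
  using smooth1D[OF assms, of 0 t] smooth1D[OF assms, of 1 t] by simp_all

lemma derivs_eqI:
  assumes "\<And>k t. (G k has_real_derivative G (Suc k) t) (at t)"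
  shows "(deriv ^^ k) (G 0) = G k"
proof (induction k)
  case (Suc k)
  then show ?case using DERIV_imp_deriv[OF assms] by auto
qed simp

text \<open>An explicit sequence closed under differentiation certifies smoothness and, through
  \<open>derivs_eqI\<close>, also computes the iterated derivatives. Smoothness of rescalings, of
  \<open>bump\<close>, of \<open>rad_lap n g\<close> and of \<open>kern n\<close> is obtained this
  way.\<close>

lemma smooth1I:
  assumes "\<And>k t. (G k has_real_derivative G (Suc k) t) (at t)"
  shows "smooth1 (G 0)"
  unfolding smooth1_def derivs_eqI[of G, OF assms] using assms by blast

lemma smooth1_deriv: "smooth1 g \<Longrightarrow> smooth1 (deriv g)"
  using smooth1D[of g "Suc _"] by (simp add: smooth1_def funpow_swap1)

lemma smooth1_continuous: "smooth1 g \<Longrightarrow> continuous_on S g"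
  by (meson DERIV_continuous_on has_field_derivative_at_within smooth1_DERIV(1))

lemma smooth1_scale:
  assumes "smooth1 g"
  shows "smooth1 (\<lambda>t. g (t * c))" and "deriv (\<lambda>t. g (t * c)) = (\<lambda>t. c * deriv g (t * c))"
proof -
  define G where "G k t = c ^ k * (deriv ^^ k) g (t * c)" for k and t :: real
  have G: "(G k has_real_derivative G (Suc k) t) (at t)" for k t
    unfolding G_def
    by (rule derivative_eq_intros DERIV_chain2[OF smooth1D[OF assms]] refl)+ simp
  have 0: "(\<lambda>t. g (t * c)) = G 0" by (simp add: G_def fun_eq_iff)
  show "smooth1 (\<lambda>t. g (t * c))" unfolding 0 by (rule smooth1I) (rule G)
  show "deriv (\<lambda>t. g (t * c)) = (\<lambda>t. c * deriv g (t * c))"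
    unfolding 0 using derivs_eqI[of G 1, OF G] by (simp add: G_def fun_eq_iff)
qed

section \<open>A smooth compactly supported bump\<close>

lemma tendsto_poly_times_exp_neg:
  fixes p :: "real poly"
  shows "((\<lambda>v. poly p v * exp (- v)) \<longlongrightarrow> 0) at_top"
proof -
  have "((\<lambda>v. \<Sum>i\<le>degree p. coeff p i * (v ^ i / exp v)) \<longlongrightarrow> (\<Sum>i\<le>degree p. coeff p i * 0)) at_top"
    by (intro tendsto_intros tendsto_power_div_exp_0)
  then show ?thesis
    by (simp add: poly_altdef sum_distrib_right exp_minus divide_inverse mult.assoc)
qed

text \<open>Polynomials in \<open>1 / (1 - t)\<close> times the classical flat exponential, a family
  closed under differentiation. The exponent \<open>- t / (1 - t) = 1 - 1 / (1 - t)\<close> is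
  normalised so that the value at 0 is \<open>poly p 1\<close>.\<close>

definition bump_poly :: "real poly \<Rightarrow> real \<Rightarrow> real" where
  "bump_poly p t = (if t < 1 then poly p (1 / (1 - t)) * exp (- (t / (1 - t))) else 0)"

definition bump :: "real \<Rightarrow> real" where "bump = bump_poly 1"

text \<open>With \<open>v = 1 / (1 - t)\<close> one has \<open>v' = v\<^sup>2\<close> and \<open>t / (1 - t) = v - 1\<close>.\<close>

lemma DERIV_bump_poly:
  "(bump_poly p has_real_derivative bump_poly ([:0, 0, 1:] * (pderiv p - p)) t) (at t)"
proof (cases t "1 :: real" rule: linorder_cases)
  case less
  have "((\<lambda>t. poly p (1 / (1 - t)) * exp (- (t / (1 - t)))) has_real_derivative
      bump_poly ([:0, 0, 1:] * (pderiv p - p)) t) (at t)"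
  proof -
    define v where "v = 1 / (1 - t)"
    have "((\<lambda>t. 1 / (1 - t)) has_real_derivative v\<^sup>2) (at t)"
      using less by (auto intro!: derivative_eq_intros simp: v_def power2_eq_square)
    moreover have "((\<lambda>t. - (t / (1 - t))) has_real_derivative - v\<^sup>2) (at t)"
      using less by (auto intro!: derivative_eq_intros simp: v_def power2_eq_square divide_simps)
    ultimately have "((\<lambda>t. poly p (1 / (1 - t)) * exp (- (t / (1 - t)))) has_real_derivative
      poly (pderiv p) (1 / (1 - t)) * v\<^sup>2 * exp (- (t / (1 - t)))
      + exp (- (t / (1 - t))) * - v\<^sup>2 * poly p (1 / (1 - t))) (at t)"
      by (intro DERIV_mult DERIV_chain2[OF poly_DERIV] DERIV_chain2[OF DERIV_exp])
    moreover have "poly (pderiv p) (1 / (1 - t)) * v\<^sup>2 * exp (- (t / (1 - t)))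
        + exp (- (t / (1 - t))) * - v\<^sup>2 * poly p (1 / (1 - t))
      = bump_poly ([:0, 0, 1:] * (pderiv p - p)) t"
      unfolding bump_poly_def if_P[OF less] v_def[symmetric] poly_mult poly_diff poly_pCons
      by (simp only: poly_0) algebra
    ultimately show ?thesis by metis
  qed
  moreover have "eventually (\<lambda>s. bump_poly p s = poly p (1 / (1 - s)) * exp (- (s / (1 - s)))) (nhds t)"
    using eventually_nhds_in_open[of "{..<1}" t] less by (auto elim!: eventually_mono simp: bump_poly_def)
  ultimately show ?thesis by (simp only: DERIV_cong_ev[OF refl _ refl])
next
  case greater
  have "((\<lambda>t. 0) has_real_derivative bump_poly ([:0, 0, 1:] * (pderiv p - p)) t) (at t)"
    using greater by (simp add: bump_poly_def)
  moreover have "eventually (\<lambda>s. bump_poly p s = 0) (nhds t)"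
    using eventually_nhds_in_open[of "{1<..}" t] greater by (auto elim!: eventually_mono simp: bump_poly_def)
  ultimately show ?thesis by (simp only: DERIV_cong_ev[OF refl _ refl])
next
  case equal
  \<comment> \<open>With \<open>v = 1 / (1 - y)\<close>, the left difference quotient at 1 is
    \<open>- v * poly p v * exp (1 - v)\<close>, that is
    \<open>poly q v * exp (- v)\<close>.\<close>
  define q where "q = smult (- exp 1) ([:0, 1:] * p)"
  have "filterlim (\<lambda>y::real. 1 / (1 - y)) at_top (at_left 1)"
    by real_asymp
  from filterlim_compose[OF tendsto_poly_times_exp_neg[of q] this]
  have "((\<lambda>y. poly q (1 / (1 - y)) * exp (- (1 / (1 - y)))) \<longlongrightarrow> 0) (at_left 1)" .
  moreover have "\<forall>\<^sub>F y in at_left 1. poly q (1 / (1 - y)) * exp (- (1 / (1 - y)))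
      = (bump_poly p y - bump_poly p 1) / (y - 1)"
  proof -
    have "poly q (1 / (1 - y)) * exp (- (1 / (1 - y))) = (bump_poly p y - bump_poly p 1) / (y - 1)"
      if y: "y < 1" for y
    proof -
      have "exp (- (y / (1 - y))) = exp (1 + (- (1 / (1 - y))))"
        using y by (intro arg_cong[of _ _ exp]) (simp add: field_simps)
      also have "\<dots> = exp 1 * exp (- (1 / (1 - y)))" by (rule exp_add)
      finally show ?thesis
        using y by (simp add: bump_poly_def q_def field_simps)
    qed
    moreover have "\<forall>\<^sub>F y in at_left 1. y < (1::real)"
      by (simp add: eventually_at_filter)
    ultimately show ?thesis by (auto elim: eventually_mono)
  qed
  ultimately have "((\<lambda>y. (bump_poly p y - bump_poly p 1) / (y - 1)) \<longlongrightarrow> 0) (at_left 1)"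
    by (rule Lim_transform_eventually)
  moreover have "((\<lambda>y. (bump_poly p y - bump_poly p 1) / (y - 1)) \<longlongrightarrow> 0) (at_right 1)"
    by (rule tendsto_eventually) (auto simp: bump_poly_def eventually_at_filter)
  ultimately have "((\<lambda>y. (bump_poly p y - bump_poly p 1) / (y - 1)) \<longlongrightarrow> 0) (at 1)"
    using filterlim_split_at by blast
  then show ?thesis unfolding equal has_field_derivative_iff by (simp add: bump_poly_def)
qed

text \<open>Iterating the polynomial operator of \<open>DERIV_bump_poly\<close>, starting from 1,
  gives the explicit sequence of derivatives.\<close>

lemma smooth1_bump: "smooth1 bump"
proof -
  define P where "P k = ((\<lambda>p. [:0, 0, 1:] * (pderiv p - p)) ^^ k) (1 :: real poly)" for k
  have "(bump_poly (P k) has_real_derivative bump_poly (P (Suc k)) t) (at t)" for k t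
    using DERIV_bump_poly[of "P k" t] by (simp only: P_def funpow.simps comp_def)
  from smooth1I[of "\<lambda>k. bump_poly (P k)", OF this] show ?thesis by (simp add: P_def bump_def)
qed

lemma bump_0 [simp]: "bump 0 = 1"
  and bump_eq_0 [simp]: "t \<ge> 1 \<Longrightarrow> bump t = 0"
  and bump_nonneg: "bump t \<ge> 0"
  by (simp_all add: bump_def bump_poly_def)

lemma bump_le_1: "t \<ge> 0 \<Longrightarrow> bump t \<le> 1"
  by (simp add: bump_def bump_poly_def)

lemma bump_ge_half: "0 \<le> t \<Longrightarrow> t \<le> 1 / 2 \<Longrightarrow> bump t \<ge> exp (- 1)"
  by (simp add: bump_def bump_poly_def divide_simps)

subsection \<open>Radial test functions\<close>

text \<open>The action of \<open>-\<Delta>\<close> in dimension \<open>2n\<close> on a profile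
  \<open>g\<close> of the variable \<open>t = |y - x|^2\<close>: the second partials sum to
  \<open>4 t g'' + 4 n g'\<close>. The squared norm is chosen because it is smooth at the
  centre.\<close>

definition rad_lap :: "nat \<Rightarrow> (real \<Rightarrow> real) \<Rightarrow> real \<Rightarrow> real" where
  "rad_lap n g t = - 4 * (t * deriv (deriv g) t + n * deriv g t)"

lemma smooth1_rad_lap:
  assumes "smooth1 g"
  shows "smooth1 (rad_lap n g)"
    and "deriv (rad_lap n g) t =
      - 4 * (t * deriv (deriv (deriv g)) t + (real n + 1) * deriv (deriv g) t)"
proof -
  define G where "G k t = - 4 * (t * (deriv ^^ (k + 2)) g t + (real n + real k) * (deriv ^^ (k + 1)) g t)"
    for k t
  have G: "(G k has_real_derivative G (Suc k) t) (at t)" for k t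
    unfolding G_def
    by (rule derivative_eq_intros smooth1D[OF assms] refl)+ (simp add: algebra_simps)
  have 0: "rad_lap n g = G 0" by (auto simp: G_def rad_lap_def fun_eq_iff numeral_2_eq_2)
  show "smooth1 (rad_lap n g)" unfolding 0 by (rule smooth1I) (rule G)
  show "deriv (rad_lap n g) t =
      - 4 * (t * deriv (deriv (deriv g)) t + (real n + 1) * deriv (deriv g) t)"
    unfolding 0 using derivs_eqI[of G 1, OF G] by (simp add: G_def numeral_2_eq_2)
qed

lemma smooth1_rad_lap_iter: "smooth1 g \<Longrightarrow> smooth1 ((rad_lap n ^^ k) g)"
  by (induction k) (auto intro: smooth1_rad_lap)

lemma rad_lap_scale:
  assumes "smooth1 g"
  shows "rad_lap n (\<lambda>t. g (t * c)) = (\<lambda>t. c * rad_lap n g (t * c))"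
proof -
  have "deriv (\<lambda>t. c * deriv g (t * c)) t = c * (c * deriv (deriv g) (t * c))" for t
    by (rule DERIV_imp_deriv)
      ((rule derivative_eq_intros DERIV_chain2[OF smooth1_DERIV(2)[OF assms]] refl)+, simp)
  then show ?thesis
    by (simp add: rad_lap_def fun_eq_iff smooth1_scale[OF assms] algebra_simps)
qed

text \<open>An algebra containing every \<open>g^(k)(|y - x|^2)\<close> and stable under all partial
  derivatives. Membership is the invariant of the induction behind \<open>C_infinity_radial\<close>,
  in place of closed forms for iterated partials.\<close>

inductive_set radial_alg :: "'a::euclidean_space \<Rightarrow> (real \<Rightarrow> real) \<Rightarrow> ('a \<Rightarrow> real) set"
  for x g where
  const: "(\<lambda>_. c) \<in> radial_alg x g"
| coord: "(\<lambda>y. (y - x) \<bullet> b) \<in> radial_alg x g"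
| radial: "(\<lambda>y. (deriv ^^ k) g ((norm (y - x))\<^sup>2)) \<in> radial_alg x g"
| add: "h \<in> radial_alg x g \<Longrightarrow> h' \<in> radial_alg x g \<Longrightarrow> (\<lambda>y. h y + h' y) \<in> radial_alg x g"
| mult: "h \<in> radial_alg x g \<Longrightarrow> h' \<in> radial_alg x g \<Longrightarrow> (\<lambda>y. h y * h' y) \<in> radial_alg x g"

lemma partial_deriv_eqI:
  assumes "\<And>y. (h has_derivative D y) (at y)"
  shows "partial_deriv b h = (\<lambda>y. D y b)"
  unfolding partial_deriv_def fun_eq_iff using frechet_derivative_at[OF assms] by metis

lemma has_derivative_radial:
  assumes "\<And>t. (g has_real_derivative g' t) (at t)"
  shows "((\<lambda>y. g ((norm (y - x))\<^sup>2)) has_derivative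
    (\<lambda>h. 2 * ((y - x) \<bullet> h) * g' ((norm (y - x))\<^sup>2))) (at y)"
proof -
  have "((\<lambda>y. (y - x) \<bullet> (y - x)) has_derivative (\<lambda>h. 2 * ((y - x) \<bullet> h))) (at y)"
    by (rule derivative_eq_intros refl)+ (simp add: inner_commute)
  then have "((\<lambda>y. (norm (y - x))\<^sup>2) has_derivative (\<lambda>h. 2 * ((y - x) \<bullet> h))) (at y)"
    by (simp only: dot_square_norm)
  from has_derivative_compose[OF this assms[THEN has_field_derivative_imp_has_derivative]]
  show ?thesis by (simp add: mult_ac)
qed

lemma radial_alg_partial_deriv:
  assumes g: "smooth1 g" and "h \<in> radial_alg x g"
  shows "(\<forall>y. h differentiable (at y)) \<and> (\<forall>b. partial_deriv b h \<in> radial_alg x g)"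
  using assms(2)
proof induction
  case (const c)
  have "partial_deriv b (\<lambda>_. c) = (\<lambda>_. 0)" for b :: 'a
    by (rule partial_deriv_eqI[of _ "\<lambda>_ _. 0"]) (rule derivative_intros)
  then show ?case by (simp add: radial_alg.const)
next
  case (coord b)
  have 1: "((\<lambda>y. (y - x) \<bullet> b) has_derivative (\<lambda>h. h \<bullet> b)) (at y)" for y
    by (rule derivative_eq_intros refl)+ simp
  show ?case using 1 by (auto simp: partial_deriv_eqI[OF 1] differentiable_def intro!: radial_alg.const)
next
  case (radial k)
  note 1 = has_derivative_radial[OF smooth1D[OF g], of k x]
  have "(\<lambda>y. 2 * ((y - x) \<bullet> b) * (deriv ^^ Suc k) g ((norm (y - x))\<^sup>2)) \<in> radial_alg x g" for b
    by (intro radial_alg.intros)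
  then show ?case using 1 by (auto simp: partial_deriv_eqI[OF 1] differentiable_def)
next
  case (add h h')
  then have 1: "((\<lambda>y. h y + h' y) has_derivative
      (\<lambda>b. frechet_derivative h (at y) b + frechet_derivative h' (at y) b)) (at y)" for y
    by (intro has_derivative_add) (auto simp: frechet_derivative_works[symmetric])
  have "partial_deriv b (\<lambda>y. h y + h' y) = (\<lambda>y. partial_deriv b h y + partial_deriv b h' y)" for b
    unfolding partial_deriv_eqI[OF 1] by (simp add: partial_deriv_def)
  then show ?case using add 1
    by (auto simp: differentiable_def intro!: radial_alg.intros)
next
  case (mult h h')
  then have 1: "((\<lambda>y. h y * h' y) has_derivative
      (\<lambda>b. h y * frechet_derivative h' (at y) b + frechet_derivative h (at y) b * h' y)) (at y)" for y
    by (intro has_derivative_mult) (auto simp: frechet_derivative_works[symmetric])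
  have "partial_deriv b (\<lambda>y. h y * h' y)
      = (\<lambda>y. h y * partial_deriv b h' y + partial_deriv b h y * h' y)" for b
    unfolding partial_deriv_eqI[OF 1] by (simp add: partial_deriv_def)
  then show ?case using mult 1
    by (auto simp: differentiable_def intro!: radial_alg.intros)
qed

lemma C_infinity_radial:
  assumes "smooth1 g"
  shows "C_infinity (\<lambda>y::'a::euclidean_space. g ((norm (y - x))\<^sup>2))"
proof -
  have "foldr partial_deriv bs (\<lambda>y. g ((norm (y - x))\<^sup>2)) \<in> radial_alg x g" for bs
  proof (induction bs)
    case Nil
    show ?case using radial_alg.radial[of 0 g x] by simp
  next
    case (Cons b bs)
    then show ?case using radial_alg_partial_deriv[OF assms] by (metis foldr_Cons comp_apply)
  qed
  then show ?thesis
    using radial_alg_partial_deriv[OF assms]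
    by (auto simp: C_infinity_def differentiable_on_def)
qed

lemma neg_laplacian_radial:
  fixes x :: "'a::euclidean_space"
  assumes g: "smooth1 g" and dim: "DIM('a) = 2 * n"
  shows "neg_laplacian (\<lambda>y. g ((norm (y - x))\<^sup>2)) = (\<lambda>y. rad_lap n g ((norm (y - x))\<^sup>2))"
proof
  fix y :: 'a
  let ?t = "(norm (y - x))\<^sup>2"
  note d1 = smooth1_DERIV(1)[OF g] and d2 = smooth1_DERIV(2)[OF g]
  have 1: "partial_deriv b (\<lambda>y. g ((norm (y - x))\<^sup>2))
      = (\<lambda>y. 2 * ((y - x) \<bullet> b) * deriv g ((norm (y - x))\<^sup>2))" for b
    by (rule partial_deriv_eqI[OF has_derivative_radial[OF d1]])
  have d: "((\<lambda>y. 2 * ((y - x) \<bullet> b) * deriv g ((norm (y - x))\<^sup>2)) has_derivative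
      (\<lambda>h. 2 * ((y - x) \<bullet> b) * (2 * ((y - x) \<bullet> h) * deriv (deriv g) ((norm (y - x))\<^sup>2))
          + 2 * (h \<bullet> b) * deriv g ((norm (y - x))\<^sup>2))) (at y)" for b y
    by (intro has_derivative_mult has_derivative_radial[OF d2])
      ((rule derivative_eq_intros refl)+, simp)
  have 2: "partial_deriv b (partial_deriv b (\<lambda>y. g ((norm (y - x))\<^sup>2))) y
      = 4 * ((y - x) \<bullet> b)\<^sup>2 * deriv (deriv g) ?t + 2 * deriv g ?t" if "b \<in> Basis" for b
    unfolding 1 partial_deriv_eqI[OF d] using that by (simp add: power2_eq_square)
  have "(\<Sum>b\<in>Basis. ((y - x) \<bullet> b)\<^sup>2) = ?t"
    unfolding power2_norm_eq_inner euclidean_inner[of "y - x" "y - x"] by (simp only: power2_eq_square)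
  then have "(\<Sum>b\<in>Basis. 4 * ((y - x) \<bullet> b)\<^sup>2 * deriv (deriv g) ?t) = 4 * ?t * deriv (deriv g) ?t"
    by (simp flip: sum_distrib_left sum_distrib_right)
  then show "neg_laplacian (\<lambda>y. g ((norm (y - x))\<^sup>2)) y = rad_lap n g ?t"
    using dim by (simp add: neg_laplacian_def 2 sum.distrib rad_lap_def)
qed

lemma neg_laplacian_iter_radial:
  fixes x :: "'a::euclidean_space"
  assumes "smooth1 g" and "DIM('a) = 2 * n"
  shows "(neg_laplacian ^^ k) (\<lambda>y. g ((norm (y - x))\<^sup>2)) = (\<lambda>y. (rad_lap n ^^ k) g ((norm (y - x))\<^sup>2))"
  using neg_laplacian_radial[OF smooth1_rad_lap_iter[OF assms(1)] assms(2)]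
  by (induction k) simp_all

text \<open>The Laplacian has degree -2 in space, hence degree -1 in the squared distance
  \<open>t\<close>, so each application contributes one factor \<open>c\<close>. With
  \<open>c = 1 / s\<close> this produces the power \<open>s^(-n)\<close>.\<close>

lemma rad_lap_iter_scale:
  assumes "smooth1 g"
  shows "(rad_lap n ^^ k) (\<lambda>t. g (t * c)) = (\<lambda>t. c ^ k * (rad_lap n ^^ k) g (t * c))"
proof (induction k)
  case (Suc k)
  let ?h = "(rad_lap n ^^ k) g"
  have h: "smooth1 ?h" using smooth1_rad_lap_iter[OF assms] .
  have "deriv (\<lambda>t. c ^ k * ?h (t * c)) = (\<lambda>t. c ^ k * deriv (\<lambda>t. ?h (t * c)) t)"
    by (rule ext, rule deriv_cmult)
      (use smooth1_DERIV(1)[OF smooth1_scale(1)[OF h, of c]] in \<open>auto simp: field_differentiable_def\<close>)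
  moreover have "deriv (\<lambda>t. c ^ k * deriv (\<lambda>t. ?h (t * c)) t) = (\<lambda>t. c ^ k * deriv (deriv (\<lambda>t. ?h (t * c))) t)"
    by (rule ext, rule deriv_cmult)
      (unfold field_differentiable_def, use smooth1_DERIV(2)[OF smooth1_scale(1)[OF h, of c]] in blast)
  ultimately have "rad_lap n (\<lambda>t. c ^ k * ?h (t * c)) = (\<lambda>t. c ^ k * rad_lap n (\<lambda>t. ?h (t * c)) t)"
    unfolding rad_lap_def by (simp add: algebra_simps)
  also have "\<dots> = (\<lambda>t. c ^ Suc k * rad_lap n ?h (t * c))"
    by (simp add: rad_lap_scale[OF h] mult_ac)
  finally show ?case by (simp add: Suc)
qed simp

lemma test_function_radial:
  fixes x :: "'a::euclidean_space"
  assumes "smooth1 g" and "\<And>t. t \<ge> R\<^sup>2 \<Longrightarrow> g t = 0" and "R \<ge> 0"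
  shows "test_function (\<lambda>y. g ((norm (y - x))\<^sup>2))"
proof -
  have "{y. g ((norm (y - x))\<^sup>2) \<noteq> 0} \<subseteq> cball x R"
  proof
    fix y assume "y \<in> {y. g ((norm (y - x))\<^sup>2) \<noteq> 0}"
    with assms(2)[of "(norm (y - x))\<^sup>2"] have "\<not> R\<^sup>2 \<le> (norm (y - x))\<^sup>2" by auto
    with assms(3) have "norm (y - x) \<le> R" by (metis linear norm_ge_zero power_mono)
    then show "y \<in> cball x R" by (simp add: dist_norm norm_minus_commute)
  qed
  then have "closure {y. g ((norm (y - x))\<^sup>2) \<noteq> 0} \<subseteq> cball x R"
    by (simp add: closure_minimal)
  then have "compact (closure {y. g ((norm (y - x))\<^sup>2) \<noteq> 0})"
    by (meson bounded_cball bounded_subset closed_closure compact_eq_bounded_closed)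
  with C_infinity_radial[OF assms(1)] show ?thesis by (simp add: test_function_def)
qed

text \<open>Beyond 1 the function is locally zero. The endpoint 1 itself follows from continuity of
  \<open>deriv g\<close>, so the conclusion has the same form as the hypothesis and can be
  iterated.\<close>

lemma deriv_vanish:
  assumes g: "smooth1 g" and 0: "\<And>t. t \<ge> 1 \<Longrightarrow> g t = 0" and t: "t \<ge> 1"
  shows "deriv g t = 0"
proof -
  have 1: "deriv g s = 0" if "s > 1" for s
  proof -
    have "\<forall>\<^sub>F r in nhds s. g r = 0"
      using eventually_nhds_in_open[of "{1<..}" s] that by (auto elim!: eventually_mono simp: 0)
    then have "(g has_real_derivative 0) (at s)"
      by (simp add: DERIV_cong_ev[OF refl _ refl, of g "\<lambda>_. 0"])
    then show ?thesis by (rule DERIV_imp_deriv)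
  qed
  have "(deriv g \<longlongrightarrow> deriv g 1) (at_right 1)"
    using smooth1_DERIV(2)[OF g, of 1] by (meson DERIV_isCont isCont_def tendsto_within_subset top_greatest)
  moreover have "(deriv g \<longlongrightarrow> 0) (at_right 1)"
    by (rule tendsto_eventually) (simp add: eventually_at_filter 1)
  ultimately have "deriv g 1 = 0" by (rule tendsto_unique[rotated]) simp
  with 1 t show ?thesis by (cases "t = 1") auto
qed

lemma rad_lap_iter_vanish:
  assumes "smooth1 g" and "\<And>t. t \<ge> 1 \<Longrightarrow> g t = 0"
  shows "t \<ge> 1 \<Longrightarrow> (rad_lap n ^^ k) g t = 0"
proof (induction k arbitrary: t)
  case (Suc k)
  let ?h = "(rad_lap n ^^ k) g"
  have h: "smooth1 ?h" using smooth1_rad_lap_iter[OF assms(1)] .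
  have 1: "deriv ?h t = 0" if "t \<ge> 1" for t using deriv_vanish[OF h Suc.IH that] .
  have "deriv (deriv ?h) t = 0" using deriv_vanish[OF smooth1_deriv[OF h] 1 Suc.prems] .
  then have "rad_lap n ?h t = 0"
    by (simp add: rad_lap_def 1[OF Suc.prems])
  then show ?case by simp
qed (use assms(2) in auto)

subsection \<open>The mass of the kernel\<close>

text \<open>Layer-cake argument: \<open>h(|y|^2)\<close> is the integral of \<open>- h'\<close> over
  \<open>[|y|^2, 1]\<close>. After exchanging the integrals, the inner one is the volume of a ball
  of radius \<open>sqrt t\<close>, which is a constant times \<open>t^n\<close> in dimension
  \<open>2n\<close>.\<close>

lemma integral_radial:
  assumes h: "smooth1 h" and h0: "\<And>t. t \<ge> 1 \<Longrightarrow> h t = 0" and dim: "DIM('a::euclidean_space) = 2 * n"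
  shows "(\<integral>y. h ((norm (y::'a))\<^sup>2) \<partial>lborel)
    = - unit_ball_vol (real (2 * n)) * integral {0..1} (\<lambda>t. t ^ n * deriv h t)"
proof -
  define \<Phi> where "\<Phi> y t = - deriv h t * indicator {0..1} t * indicator {z::'a. (norm z)\<^sup>2 \<le> t} y" for y t
  have cont: "continuous_on S (deriv h)" for S using smooth1_continuous[OF smooth1_deriv[OF h]] .
  obtain M where M: "\<And>t. t \<in> {0..1} \<Longrightarrow> \<bar>deriv h t\<bar> \<le> M"
    using compact_imp_bounded[OF compact_continuous_image[OF cont compact_Icc[of 0 1]]]
    unfolding bounded_iff real_norm_def by (metis imageI)
  have M0: "M \<ge> 0" using M[of 0] by (smt (verit) atLeastAtMost_iff)
  have [measurable]: "deriv h \<in> borel_measurable borel"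
    using cont borel_measurable_continuous_onI by blast
  have meas: "case_prod \<Phi> \<in> borel_measurable (lborel \<Otimes>\<^sub>M lborel)"
    unfolding \<Phi>_def case_prod_unfold indicator_def of_bool_def mem_Collect_eq by measurable
  have int: "integrable (lborel \<Otimes>\<^sub>M lborel) (case_prod \<Phi>)"
  proof (rule Bochner_Integration.integrable_bound[OF _ meas])
    show "integrable (lborel \<Otimes>\<^sub>M lborel) (\<lambda>z. M * indicator (cball (0::'a) 1 \<times> {0..1::real}) z)"
      unfolding lborel_prod
      by (intro integrable_mult_right integrable_real_indicator emeasure_bounded_finite)
        (auto intro!: bounded_Times borel_compact compact_Times)
    show "AE z in lborel \<Otimes>\<^sub>M lborel. norm (case_prod \<Phi> z) \<le> norm (M * indicator (cball (0::'a) 1 \<times> {0..1::real}) z)"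
    proof (rule AE_I2)
      fix z :: "'a \<times> real"
      have "norm y \<le> 1" if "(norm y)\<^sup>2 \<le> t" "t \<le> 1" for y :: 'a and t
        using that power2_le_imp_le[of "norm y" 1] by simp
      then show "norm (case_prod \<Phi> z) \<le> norm (M * indicator (cball (0::'a) 1 \<times> {0..1::real}) z)"
        using M M0 by (cases z) (auto simp: \<Phi>_def indicator_def)
    qed
  qed
  have inner_t: "(\<integral>t. \<Phi> y t \<partial>lborel) = h ((norm y)\<^sup>2)" for y
  proof (cases "(norm y)\<^sup>2 \<le> 1")
    case True
    have "((\<lambda>t. - deriv h t) has_integral (- h 1 - - h ((norm y)\<^sup>2))) {(norm y)\<^sup>2..1}"
      using True DERIV_minus[OF smooth1_DERIV(1)[OF h]]
      by (intro fundamental_theorem_of_calculus)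
        (auto simp flip: has_real_derivative_iff_has_vector_derivative
          intro: DERIV_subset)
    moreover have "set_integrable lborel {(norm y)\<^sup>2..1} (\<lambda>t. - deriv h t)"
      by (intro borel_integrable_atLeastAtMost') (intro continuous_intros cont)
    ultimately have "(LINT t:{(norm y)\<^sup>2..1}|lborel. - deriv h t) = h ((norm y)\<^sup>2)"
      using h0[of 1] by (simp only: set_borel_integral_eq_integral(2) integral_unique)
    moreover have "\<Phi> y t = indicator {(norm y)\<^sup>2..1} t *\<^sub>R (- deriv h t)" for t
      by (auto simp: \<Phi>_def indicator_def) (smt (verit) zero_le_power2)
    ultimately show ?thesis by (simp add: set_lebesgue_integral_def)
  next
    case False
    then have "\<Phi> y t = 0" for t by (auto simp: \<Phi>_def indicator_def)
    with False show ?thesis using h0 by simp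
  qed
  have inner_y: "(\<integral>y. \<Phi> y t \<partial>lborel) = indicator {0..1} t *\<^sub>R (- unit_ball_vol (real (2 * n)) * (t ^ n * deriv h t))" for t
  proof (cases "t \<in> {0..1}")
    case True
    then have "{z::'a. (norm z)\<^sup>2 \<le> t} = cball 0 (sqrt t)"
      by (auto simp: real_le_rsqrt) (metis norm_ge_zero power_mono real_sqrt_pow2)
    with True show ?thesis
      using dim by (simp add: \<Phi>_def content_cball power_mult)
  qed (auto simp: \<Phi>_def)
  have "(\<integral>y. h ((norm (y::'a))\<^sup>2) \<partial>lborel) = (\<integral>y. \<integral>t. \<Phi> y t \<partial>lborel \<partial>lborel)"
    by (simp add: inner_t)
  also have "\<dots> = (\<integral>t. \<integral>y. \<Phi> y t \<partial>lborel \<partial>lborel)"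
    using lborel_pair.Fubini_integral[OF int] by simp
  also have "\<dots> = (LINT t:{0..1}|lborel. - unit_ball_vol (real (2 * n)) * (t ^ n * deriv h t))"
    by (simp add: inner_y set_lebesgue_integral_def)
  also have "\<dots> = integral {0..1} (\<lambda>t. - unit_ball_vol (real (2 * n)) * (t ^ n * deriv h t))"
    by (intro set_borel_integral_eq_integral borel_integrable_atLeastAtMost') (intro continuous_intros cont)
  finally show ?thesis by simp
qed

text \<open>The exact derivative \<open>a - c b\<close> of a function vanishing at both ends has
  integral 0; the integrations by parts below are instances, with \<open>F\<close> as the boundary
  term.\<close>

lemma integral_by_parts_Icc:
  fixes F a b :: "real \<Rightarrow> real"
  assumes "\<And>t. (F has_real_derivative a t - c * b t) (at t)" and "F 0 = 0" and "F 1 = 0"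
    and "continuous_on UNIV b"
  shows "integral {0..1} a = c * integral {0..1} b"
proof -
  have "((\<lambda>t. a t - c * b t) has_integral F 1 - F 0) {0..1}"
    using assms(1)
    by (intro fundamental_theorem_of_calculus)
      (auto simp flip: has_real_derivative_iff_has_vector_derivative intro: DERIV_subset)
  moreover have "((\<lambda>t. c * b t) has_integral c * integral {0..1} b) {0..1}"
    using assms(4)
    by (intro has_integral_mult_right integrable_integral integrable_continuous_real)
      (rule continuous_on_subset, auto)
  ultimately have "((\<lambda>t. a t - c * b t + c * b t) has_integral (F 1 - F 0 + c * integral {0..1} b)) {0..1}"
    by (rule has_integral_add)
  then show ?thesis using assms(2,3) by (simp add: integral_unique)
qed

lemma integral_deriv_rad_lap:
  assumes g: "smooth1 g" and g0: "\<And>t. t \<ge> 1 \<Longrightarrow> g t = 0"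
  shows "integral {0..1} (\<lambda>t. t ^ Suc j * deriv (rad_lap n g) t)
    = 4 * (real j + 1) * (real n - real j - 1) * integral {0..1} (\<lambda>t. t ^ j * deriv g t)"
proof (rule integral_by_parts_Icc)
  \<comment> \<open>The first summand is the boundary term of integrating
    \<open>(rad_lap n g)'\<close> by parts; the second removes the term in \<open>g''\<close> left
    by the first, so that only a multiple of \<open>t^j g'\<close> remains.\<close>
  let ?F = "\<lambda>t. t ^ Suc j * rad_lap n g t + 4 * (real j + 1) * t ^ Suc j * deriv g t"
  note dv = deriv_vanish[OF g g0] and dv2 = deriv_vanish[OF smooth1_deriv[OF g] deriv_vanish[OF g g0]]
  show "(?F has_real_derivative t ^ Suc j * deriv (rad_lap n g) t
      - 4 * (real j + 1) * (real n - real j - 1) * (t ^ j * deriv g t)) (at t)" for t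
    by (rule derivative_eq_intros smooth1_DERIV[OF g] smooth1_DERIV(1)[OF smooth1_rad_lap(1)[OF g]] refl)+
      (simp add: rad_lap_def algebra_simps)
  show "?F 1 = 0" using dv[of 1] dv2[of 1] by (simp add: rad_lap_def)
  show "continuous_on UNIV (\<lambda>t. t ^ j * deriv g t)"
    by (intro continuous_intros smooth1_continuous smooth1_deriv g)
qed simp

text \<open>Each application of \<open>rad_lap\<close> is paid for by one more power of
  \<open>t\<close>, via \<open>integral_deriv_rad_lap\<close>; the start value is
  \<open>bump 1 - bump 0 = -1\<close>. The bound \<open>j < n\<close> keeps every factor
  \<open>n - j - 1\<close> positive in the induction step.\<close>

lemma integral_deriv_rad_lap_iter_bump:
  "j < n \<Longrightarrow> integral {0..1} (\<lambda>t. t ^ j * deriv ((rad_lap n ^^ j) bump) t)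
    = - (4 ^ j * fact j * fact (n - 1) / fact (n - 1 - j))"
proof (induction j)
  case 0
  have "((\<lambda>t. deriv bump t) has_integral (bump 1 - bump 0)) {0..1}"
    using smooth1_DERIV(1)[OF smooth1_bump]
    by (intro fundamental_theorem_of_calculus)
      (auto simp flip: has_real_derivative_iff_has_vector_derivative intro: DERIV_subset)
  then show ?case by (simp add: integral_unique)
next
  case (Suc j)
  then have f: "(fact (n - 1 - j) :: real) = (real n - real j - 1) * fact (n - 1 - Suc j)"
    by (subst fact_reduce) (auto simp: of_nat_diff)
  have "real n - real j - 1 > 0" using Suc.prems by linarith
  have "integral {0..1} (\<lambda>t. t ^ Suc j * deriv ((rad_lap n ^^ Suc j) bump) t)
      = 4 * (real j + 1) * (real n - real j - 1)
        * integral {0..1} (\<lambda>t. t ^ j * deriv ((rad_lap n ^^ j) bump) t)"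
    using integral_deriv_rad_lap[OF smooth1_rad_lap_iter[OF smooth1_bump]
        rad_lap_iter_vanish[OF smooth1_bump bump_eq_0]] by simp
  also have "\<dots> = 4 * (real j + 1) * (real n - real j - 1)
        * - (4 ^ j * fact j * fact (n - 1) / ((real n - real j - 1) * fact (n - 1 - Suc j)))"
    using Suc f by simp
  also have "\<dots> = - (4 ^ Suc j * fact (Suc j) * fact (n - 1) / fact (n - 1 - Suc j))"
    using \<open>real n - real j - 1 > 0\<close> by (simp add: divide_simps)
  finally show ?case .
qed

text \<open>Chosen such that
  \<open>d/ds (s\<^sup>-\<^sup>n kern n (t / s)) = - s\<^bsup>-(n+1)\<^esup> ((rad_lap n ^^ n) bump) (t / s)\<close>.\<close>

definition kern :: "nat \<Rightarrow> real \<Rightarrow> real" where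
  "kern n t = - 4 * deriv ((rad_lap n ^^ (n - 1)) bump) t"

lemma smooth1_kern: "smooth1 (kern n)"
proof -
  let ?G = "(rad_lap n ^^ (n - 1)) bump"
  have "smooth1 ?G" by (rule smooth1_rad_lap_iter[OF smooth1_bump])
  define G where "G k t = - 4 * (deriv ^^ Suc k) ?G t" for k t
  have G: "(G k has_real_derivative G (Suc k) t) (at t)" for k t
    unfolding G_def using DERIV_cmult[OF smooth1D[OF \<open>smooth1 ?G\<close>, of "Suc k" t]] .
  have 0: "kern n = G 0" by (simp add: G_def kern_def fun_eq_iff)
  show ?thesis unfolding 0 by (rule smooth1I) (rule G)
qed

lemma kern_vanish: "t \<ge> 1 \<Longrightarrow> kern n t = 0"
  using deriv_vanish[OF smooth1_rad_lap_iter[OF smooth1_bump]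
      rad_lap_iter_vanish[OF smooth1_bump bump_eq_0]] by (simp add: kern_def)

text \<open>With \<open>G\<close> the iterate of order \<open>n - 1\<close>,
  \<open>kern n = -4 G'\<close> turns \<open>rad_lap n G = -4 (t G'' + n G')\<close> into
  \<open>n * kern + t * kern'\<close>, the combination that arises on differentiating
  \<open>s^(-n) kern n (t / s)\<close> in \<open>s\<close>.\<close>

lemma rad_lap_iter_bump_eq_kern:
  assumes "n \<ge> 1"
  shows "(rad_lap n ^^ n) bump t = real n * kern n t + t * deriv (kern n) t"
proof -
  let ?G = "(rad_lap n ^^ (n - 1)) bump"
  have "deriv (kern n) t = - 4 * deriv (deriv ?G) t"
    unfolding kern_def
    by (rule DERIV_imp_deriv, rule DERIV_cmult)
      (rule smooth1_DERIV(2)[OF smooth1_rad_lap_iter[OF smooth1_bump]])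
  moreover have "(rad_lap n ^^ n) bump = rad_lap n ?G"
    using assms by (cases n) simp_all
  ultimately show ?thesis by (simp add: rad_lap_def kern_def algebra_simps)
qed

text \<open>\<open>integral_radial\<close> followed by one integration by parts reduces the mass to
  the moment of order \<open>n - 1\<close> of \<open>kern n\<close>, which is the last case
  \<open>j = n - 1\<close> of \<open>integral_deriv_rad_lap_iter_bump\<close>.\<close>

lemma integral_kern:
  assumes "n \<ge> 1" and dim: "DIM('a::euclidean_space) = 2 * n"
  shows "(\<integral>y. kern n ((norm (y::'a))\<^sup>2) \<partial>lborel) = 2 * gamma_n n"
proof -
  obtain m where m: "n = Suc m" using assms(1) by (cases n) auto
  have "integral {0..1} (\<lambda>t. t ^ n * deriv (kern n) t)
      = - real n * integral {0..1} (\<lambda>t. t ^ m * kern n t)"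
  proof (rule integral_by_parts_Icc)
    show "((\<lambda>t. t ^ n * kern n t) has_real_derivative
        t ^ n * deriv (kern n) t - - real n * (t ^ m * kern n t)) (at t)" for t
      unfolding m by (rule DERIV_cong, rule DERIV_mult[OF DERIV_pow smooth1_DERIV(1)[OF smooth1_kern]])
        (simp add: algebra_simps)
  next
    show "continuous_on UNIV (\<lambda>t. t ^ m * kern n t)"
      by (intro continuous_on_mult continuous_on_power continuous_on_id smooth1_continuous[OF smooth1_kern])
  qed (use assms in \<open>auto simp: kern_vanish\<close>)
  also have "integral {0..1} (\<lambda>t. t ^ m * kern n t) = 4 ^ n * (fact m)\<^sup>2"
  proof -
    have "(\<lambda>t. t ^ m * kern n t) = (\<lambda>t. - 4 * (t ^ m * deriv ((rad_lap n ^^ m) bump) t))"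
      using m by (auto simp: kern_def)
    moreover have "integral {0..1} (\<lambda>t. - 4 * (t ^ m * deriv ((rad_lap n ^^ m) bump) t))
        = - 4 * integral {0..1} (\<lambda>t. t ^ m * deriv ((rad_lap n ^^ m) bump) t)"
      by (rule integral_mult_right)
    ultimately show ?thesis
      using integral_deriv_rad_lap_iter_bump[of m n] m by (simp add: power2_eq_square)
  qed
  finally have "(\<integral>y. kern n ((norm (y::'a))\<^sup>2) \<partial>lborel)
      = unit_ball_vol (real (2 * n)) * real n * 4 ^ n * (fact m)\<^sup>2"
    by (simp add: integral_radial[OF smooth1_kern kern_vanish dim])
  also have "unit_ball_vol (real (2 * n)) = pi ^ n / fact n" by (rule unit_ball_vol_even)
  also have "(fact n :: real) = real n * fact m" using m by simp
  also have "pi ^ n / (real n * fact m) * real n * 4 ^ n * (fact m)\<^sup>2 = 4 ^ n * fact m * pi ^ n"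
    using assms(1) by (simp add: power2_eq_square)
  also have "\<dots> = 2 * gamma_n n"
    using m by (simp add: gamma_n_closed_form power_mult power2_eq_square[of 2, symmetric])
  finally show ?thesis .
qed

section \<open>Bounds for radial profiles and integrals over balls\<close>

lemma smooth1_bounded:
  assumes g: "smooth1 g" and g0: "\<And>t. t \<ge> 1 \<Longrightarrow> g t = 0"
  obtains M where "M > 0" and "\<And>t. t \<ge> 0 \<Longrightarrow> \<bar>g t\<bar> \<le> M"
proof -
  obtain M where M: "M > 0" "\<And>t. t \<in> {0..1} \<Longrightarrow> \<bar>g t\<bar> \<le> M"
    using compact_imp_bounded[OF compact_continuous_image[OF smooth1_continuous[OF g] compact_Icc[of 0 1]]]
    unfolding bounded_pos real_norm_def by (metis imageI)
  then have "\<bar>g t\<bar> \<le> M" if "t \<ge> 0" for t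
    using that g0[of t] by (cases "t \<le> 1") auto
  with M(1) that show ?thesis by blast
qed

text \<open>The Lipschitz bound is in the radius, not in its square, so that the triangle inequality
  compares a kernel centred at \<open>x\<close> with one centred at 0. The derivative
  \<open>2 r g'(r^2)\<close> is bounded because \<open>g'\<close> vanishes from 1 on.\<close>

lemma radial_lipschitz:
  assumes g: "smooth1 g" and g0: "\<And>t. t \<ge> 1 \<Longrightarrow> g t = 0"
  obtains L where "L > 0" and "\<And>r r'. \<bar>g (r\<^sup>2) - g (r'\<^sup>2)\<bar> \<le> L * \<bar>r - r'\<bar>"
proof -
  obtain M where M: "M > 0" "\<And>t. t \<ge> 0 \<Longrightarrow> \<bar>deriv g t\<bar> \<le> M"
    using smooth1_bounded[OF smooth1_deriv[OF g] deriv_vanish[OF g g0]] by blast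
  have d: "((\<lambda>r. g (r\<^sup>2)) has_real_derivative deriv g (r\<^sup>2) * (2 * r)) (at r)" for r
    by (rule DERIV_chain2[OF smooth1_DERIV(1)[OF g]]) (auto intro!: derivative_eq_intros)
  have b: "\<bar>deriv g (r\<^sup>2) * (2 * r)\<bar> \<le> 2 * M" for r
  proof (cases "\<bar>r\<bar> \<le> 1")
    case True
    have "\<bar>deriv g (r\<^sup>2)\<bar> * (2 * \<bar>r\<bar>) \<le> M * (2 * 1)"
      using True M by (intro mult_mono) auto
    then show ?thesis by (simp add: abs_mult)
  next
    case False
    then have "r\<^sup>2 \<ge> 1" by (metis abs_square_le_1 linear)
    with deriv_vanish[OF g g0] M(1) show ?thesis by simp
  qed
  have "norm (g (r\<^sup>2) - g (r'\<^sup>2)) \<le> 2 * M * norm (r - r')" for r r'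
    by (rule field_differentiable_bound[of UNIV]) (use d b in \<open>auto simp: has_field_derivative_at_within\<close>)
  with M(1) that[of "2 * M"] show ?thesis by simp
qed

lemma integrable_vanishing_outside_cball:
  fixes h :: "'a::euclidean_space \<Rightarrow> real"
  assumes "continuous_on UNIV h" and "\<And>y. norm (y - x) > r \<Longrightarrow> h y = 0"
  shows "integrable lborel h"
proof -
  have "integrable lborel (\<lambda>y. indicator (cball x r) y *\<^sub>R h y)"
    by (rule borel_integrable_compact) (auto intro: continuous_on_subset[OF assms(1)])
  also have "(\<lambda>y. indicator (cball x r) y *\<^sub>R h y) = h"
    using assms(2) by (force simp: indicator_def dist_norm norm_minus_commute)
  finally show ?thesis .
qed

lemma integral_vanishing_outside_cball_bound:
  fixes h :: "'a::euclidean_space \<Rightarrow> real"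
  assumes "continuous_on UNIV h" and "\<And>y. norm (y - x) > r \<Longrightarrow> h y = 0"
    and "\<And>y. norm (y - x) \<le> r \<Longrightarrow> \<bar>h y\<bar> \<le> B" and "r \<ge> 0"
  shows "\<bar>\<integral>y. h y \<partial>lborel\<bar> \<le> B * (unit_ball_vol DIM('a) * r ^ DIM('a))"
proof -
  have int_h: "integrable lborel h" by (rule integrable_vanishing_outside_cball[OF assms(1,2)])
  have int: "integrable lborel (\<lambda>y. B * indicator (cball x r) y)"
    by (intro integrable_mult_right integrable_real_indicator emeasure_bounded_finite) auto
  have "norm (\<integral>y. h y \<partial>lborel) \<le> (\<integral>y. B * indicator (cball x r) y \<partial>lborel)"
    by (rule Bochner_Integration.integral_norm_bound_integral)
      (use int_h int assms(2,3)
        in \<open>auto simp: indicator_def dist_norm norm_minus_commute not_le\<close>)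
  also have "\<dots> = B * (unit_ball_vol DIM('a) * r ^ DIM('a))"
    using assms(4) by (simp add: content_cball)
  finally show ?thesis by simp
qed

text \<open>Passes to the gauge integral over a box, where the Leibniz rule for parameter integrals
  can be applied.\<close>

lemma integral_eq_integral_cbox:
  fixes h :: "'a::euclidean_space \<Rightarrow> real"
  assumes "continuous_on UNIV h" and "\<And>y. norm (y - x) > r \<Longrightarrow> h y = 0" and "cball x r \<subseteq> cbox a b"
  shows "(\<integral>y. h y \<partial>lborel) = integral (cbox a b) h"
proof -
  have "(h has_integral integral (cbox a b) h) (cbox a b)"
    by (intro integrable_integral integrable_continuous continuous_on_subset[OF assms(1)]) simp
  then have "(h has_integral integral (cbox a b) h) UNIV"
    by (rule has_integral_on_superset)
      (use assms(2,3) in \<open>force simp: dist_norm norm_minus_commute\<close>)+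
  moreover have "(h has_integral (\<integral>y. h y \<partial>lborel)) UNIV"
    using integrable_vanishing_outside_cball[OF assms(1,2)] by (rule has_integral_integral_lborel)
  ultimately show ?thesis by (metis has_integral_unique)
qed

lemma lborel_integral_affine:
  fixes g :: "'a::euclidean_space \<Rightarrow> real"
  assumes [measurable]: "g \<in> borel_measurable borel" and "c \<noteq> 0"
  shows "(\<integral>y. g y \<partial>lborel) = \<bar>c\<bar> ^ DIM('a) * (\<integral>z. g (x + c *\<^sub>R z) \<partial>lborel)"
proof -
  have "(\<integral>y. g y \<partial>lborel)
      = (\<integral>y. g y \<partial>density (distr lborel borel (\<lambda>z. x + c *\<^sub>R z)) (\<lambda>_. \<bar>c\<bar> ^ DIM('a)))"
    by (subst lborel_affine[OF assms(2), of x]) simp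
  also have "\<dots> = (\<integral>y. \<bar>c\<bar> ^ DIM('a) *\<^sub>R g y \<partial>distr lborel borel (\<lambda>z. x + c *\<^sub>R z))"
    by (rule integral_density) auto
  also have "\<dots> = \<bar>c\<bar> ^ DIM('a) * (\<integral>z. g (x + c *\<^sub>R z) \<partial>lborel)"
    by (subst integral_distr) auto
  finally show ?thesis .
qed

subsection \<open>Radial means\<close>

text \<open>\<open>f\<close> stands for \<open>K exp(2nu)\<close>; of it only continuity and the
  tested equation are recorded here.\<close>

locale radial_means =
  fixes u f :: "'a::euclidean_space \<Rightarrow> real" and n :: nat
  assumes n: "n \<ge> 1" and dim: "DIM('a) = 2 * n"
    and cont_u: "continuous_on UNIV u" and cont_f: "continuous_on UNIV f"
    and eq: "\<And>\<phi>. test_function \<phi> \<Longrightarrow>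
      (\<integral>x. u x * (neg_laplacian ^^ n) \<phi> x \<partial>lborel) = (\<integral>x. f x * \<phi> x \<partial>lborel)"
begin

text \<open>The parameter \<open>s\<close> is a squared radius: the weight lives on the ball of
  radius \<open>sqrt s\<close> about \<open>x\<close>, and its total mass is
  \<open>2 * gamma_n n\<close> for every \<open>s > 0\<close>.\<close>

definition W :: "'a \<Rightarrow> real \<Rightarrow> real" where
  "W x s = (\<integral>y. u y * kern n ((norm (y - x))\<^sup>2 / s) / s ^ n \<partial>lborel)"

definition F :: "'a \<Rightarrow> real \<Rightarrow> real" where
  "F x s = (\<integral>y. f y * bump ((norm (y - x))\<^sup>2 / s) \<partial>lborel)"

lemma norm_square_div_ge_1: "s > 0 \<Longrightarrow> norm (y - x) > sqrt s \<Longrightarrow> (norm (y - x))\<^sup>2 / s \<ge> 1"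
  using real_le_lsqrt[of s "norm (y - x)"] by (simp add: real_less_lsqrt sqrt_le_D less_imp_le)

lemma cont_scaled:
  fixes x :: 'a
  assumes "s > 0" and "continuous_on UNIV g"
  shows "continuous_on UNIV (\<lambda>y. g ((norm (y - x))\<^sup>2 / s))"
  by (rule continuous_on_compose2[OF assms(2)]) (use assms(1) in \<open>auto intro!: continuous_intros\<close>)

lemmas cont_kern = cont_scaled[OF _ smooth1_continuous[OF smooth1_kern]]
  and cont_bump = cont_scaled[OF _ smooth1_continuous[OF smooth1_bump]]

text \<open>This is the equation tested with the bump of radius \<open>sqrt s\<close>; the factor
  \<open>s^n\<close> undoes the scaling of the \<open>n\<close> Laplacians.\<close>

lemma integral_u_rad_lap_iter:
  assumes s: "s > 0"
  shows "(\<integral>y. u y * (rad_lap n ^^ n) bump ((norm (y - x))\<^sup>2 / s) \<partial>lborel) = s ^ n * F x s"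
proof -
  let ?g = "\<lambda>t. bump (t * (1 / s))"
  have g: "smooth1 ?g" by (rule smooth1_scale[OF smooth1_bump])
  have "test_function (\<lambda>y. ?g ((norm (y - x))\<^sup>2))"
    by (rule test_function_radial[OF g, of "sqrt s"]) (use s in auto)
  from eq[OF this] have "(1 / s) ^ n * (\<integral>y. u y * (rad_lap n ^^ n) bump ((norm (y - x))\<^sup>2 / s) \<partial>lborel) = F x s"
    unfolding neg_laplacian_iter_radial[OF g dim] rad_lap_iter_scale[OF smooth1_bump]
    by (simp add: F_def mult.left_commute[of _ "(1 / s) ^ n"])
  then show ?thesis using s by (simp add: field_simps)
qed

text \<open>Differentiation under the integral turns the kernel into
  \<open>(rad_lap n ^^ n) bump\<close>, to which the equation applies.\<close>

lemma W_DERIV: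
  assumes s: "s > 0"
  shows "(W x has_real_derivative - F x s / s) (at s)"
proof -
  define \<kappa> where "\<kappa> = (rad_lap n ^^ n) bump"
  have \<kappa>: "smooth1 \<kappa>" unfolding \<kappa>_def by (rule smooth1_rad_lap_iter[OF smooth1_bump])
  define h where "h s y = u y * kern n ((norm (y - x))\<^sup>2 / s) / s ^ n" for s y
  define h' where "h' s y = - (u y * \<kappa> ((norm (y - x))\<^sup>2 / s) / s ^ Suc n)" for s y
  \<comment> \<open>One box containing the supports for all parameters in \<open>(s/2, 2s)\<close>,
    so that near \<open>s\<close> the domain of integration does not move.\<close>
  obtain a b where ab: "cball x (sqrt (2 * s)) \<subseteq> cbox a b"
    using bounded_subset_cbox_symmetric[OF bounded_cball] by metis
  let ?U = "{s / 2<..<2 * s}"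
  have cont_h: "continuous_on UNIV (h r)" if "r > 0" for r
    unfolding h_def using that by (intro continuous_intros cont_u cont_kern) auto
  have cont_h': "continuous_on UNIV (h' r)" if "r > 0" for r
    unfolding h'_def using that
    by (intro continuous_intros cont_u cont_scaled smooth1_continuous \<kappa>) auto
  have W: "W x r = integral (cbox a b) (h r)" if "r \<in> ?U" for r
  proof -
    have "r > 0" using that s by simp
    have "cball x (sqrt r) \<subseteq> cbox a b"
      using that by (intro subset_trans[OF subset_cball ab]) simp
    show ?thesis unfolding W_def h_def[symmetric]
    proof (rule integral_eq_integral_cbox[OF cont_h])
      show "h r y = 0" if "norm (y - x) > sqrt r" for y
        using norm_square_div_ge_1[OF \<open>r > 0\<close> that] kern_vanish by (simp add: h_def)
    qed fact+
  qed
  have "((\<lambda>r. integral (cbox a b) (h r)) has_real_derivative integral (cbox a b) (h' s)) (at s within ?U)"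
  proof (rule leibniz_rule_field_derivative)
    fix r y assume r: "r \<in> ?U"
    then have r0: "r > 0" using s by auto
    let ?T = "(norm (y - x))\<^sup>2"
    have "((\<lambda>r. ?T / r) has_real_derivative - ?T / r\<^sup>2) (at r)"
      using r0 by (auto intro!: derivative_eq_intros simp: power2_eq_square)
    from DERIV_chain2[OF smooth1_DERIV(1)[OF smooth1_kern] this, of n]
    have "((\<lambda>r. u y * kern n (?T / r) / r ^ n) has_real_derivative
      u y * ((deriv (kern n) (?T / r) * (- ?T / r\<^sup>2) * r ^ n
        - kern n (?T / r) * (real n * r ^ (n - 1))) / (r ^ n * r ^ n))) (at r)"
      using r0 by (auto intro!: derivative_eq_intros) (simp add: algebra_simps)
    also have "u y * ((deriv (kern n) (?T / r) * (- ?T / r\<^sup>2) * r ^ n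
        - kern n (?T / r) * (real n * r ^ (n - 1))) / (r ^ n * r ^ n)) = h' r y"
    proof -
      obtain m where m: "n = Suc m" using n by (cases n) auto
      define d k where "d = deriv (kern n) (?T / r)" and "k = kern n (?T / r)"
      have "(d * (- ?T / r\<^sup>2) * r ^ n - k * (real n * r ^ (n - 1))) / (r ^ n * r ^ n)
        = - ((real n * k + ?T / r * d) / r ^ Suc n)"
        using r0 unfolding m by (simp add: field_simps power2_eq_square)
      then show ?thesis
        unfolding h'_def \<kappa>_def rad_lap_iter_bump_eq_kern[OF n] d_def k_def
        by (metis mult_minus_right times_divide_eq_right)
    qed
    finally show "((\<lambda>r. h r y) has_real_derivative h' r y) (at r within ?U)"
      unfolding h_def by (rule has_field_derivative_at_within)
  next
    fix r assume "r \<in> ?U"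
    then have "r > 0" using s by auto
    then show "h r integrable_on cbox a b"
      by (intro integrable_continuous continuous_on_subset[OF cont_h]) auto
  next
    have "continuous_on (?U \<times> cbox a b) (\<lambda>z. h' (fst z) (snd z))"
      unfolding h'_def using s
      by (intro continuous_intros continuous_on_compose2[OF cont_u] continuous_on_compose2[OF smooth1_continuous[OF \<kappa>, of UNIV]]) auto
    then show "continuous_on (?U \<times> cbox a b) (\<lambda>(r, y). h' r y)"
      by (simp add: case_prod_unfold)
  qed (use s in auto)
  then have "((\<lambda>r. integral (cbox a b) (h r)) has_real_derivative integral (cbox a b) (h' s)) (at s)"
    using s by (simp add: at_within_open[of s ?U])
  moreover have "integral (cbox a b) (h' s) = - F x s / s"
  proof -
    have "integral (cbox a b) (h' s) = (\<integral>y. h' s y \<partial>lborel)"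
    proof (rule integral_eq_integral_cbox[symmetric, OF cont_h'[OF s]])
      show "cball x (sqrt s) \<subseteq> cbox a b" using s by (intro subset_trans[OF subset_cball ab]) auto
      show "h' s y = 0" if "norm (y - x) > sqrt s" for y
        using norm_square_div_ge_1[OF s that] rad_lap_iter_vanish[OF smooth1_bump bump_eq_0]
        by (simp add: h'_def \<kappa>_def)
    qed
    also have "\<dots> = (\<integral>y. - (1 / s ^ Suc n) * (u y * \<kappa> ((norm (y - x))\<^sup>2 / s)) \<partial>lborel)"
      by (rule Bochner_Integration.integral_cong) (simp_all add: h'_def)
    also have "\<dots> = - (1 / s ^ Suc n) * (\<integral>y. u y * \<kappa> ((norm (y - x))\<^sup>2 / s) \<partial>lborel)"
      by (rule integral_mult_right_zero)
    also have "\<dots> = - F x s / s"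
      unfolding \<kappa>_def integral_u_rad_lap_iter[OF s] using s by simp
    finally show ?thesis .
  qed
  moreover have "\<forall>\<^sub>F r in nhds s. W x r = integral (cbox a b) (h r)"
    using eventually_nhds_in_open[of ?U s] s by (auto elim!: eventually_mono simp: W)
  ultimately show ?thesis by (simp only: DERIV_cong_ev[OF refl _ refl])
qed

lemma integral_kern_scaled:
  fixes x :: 'a
  assumes s: "s > 0"
  shows "(\<integral>y. kern n ((norm (y - x))\<^sup>2 / s) / s ^ n \<partial>lborel) = 2 * gamma_n n"
proof -
  have "(\<integral>y. kern n ((norm (y - x))\<^sup>2 / s) \<partial>lborel)
      = \<bar>sqrt s\<bar> ^ DIM('a) * (\<integral>z. kern n ((norm ((x + sqrt s *\<^sub>R z) - x))\<^sup>2 / s) \<partial>lborel)"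
    by (rule lborel_integral_affine[of "\<lambda>y. kern n ((norm (y - x))\<^sup>2 / s)"])
      (use s cont_kern borel_measurable_continuous_onI in auto)
  also have "\<dots> = s ^ n * (2 * gamma_n n)"
    using s by (simp add: power_mult_distrib integral_kern[OF n dim] dim power_mult)
  finally show ?thesis using s by simp
qed

lemma W_tendsto_at_right_0: "(W x \<longlongrightarrow> 2 * gamma_n n * u x) (at_right 0)"
proof (rule tendstoI)
  fix e :: real assume e: "e > 0"
  obtain M where M: "M > 0" "\<And>t. t \<ge> 0 \<Longrightarrow> \<bar>kern n t\<bar> \<le> M"
    using smooth1_bounded[OF smooth1_kern kern_vanish] by blast
  define V where "V = unit_ball_vol (real DIM('a))"
  have V: "V > 0" by (simp add: V_def)
  \<comment> \<open>The kernel is at most \<open>M / s^n\<close> on a ball of volume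
    \<open>V s^n\<close>, so an oscillation \<open>e'\<close> of \<open>u\<close> changes the mean
    by at most \<open>e' * M * V = e / 2\<close>.\<close>
  define e' where "e' = e / (2 * M * V)"
  have e': "e' > 0" using e M V by (simp add: e'_def)
  obtain d where d: "d > 0" "\<And>y. norm (y - x) < d \<Longrightarrow> \<bar>u y - u x\<bar> < e'"
    using cont_u e' unfolding continuous_on_iff dist_norm real_norm_def by blast
  have "dist (W x s) (2 * gamma_n n * u x) < e" if s: "s > 0" "s < d\<^sup>2" for s
  proof -
    let ?k = "\<lambda>y. kern n ((norm (y - x))\<^sup>2 / s) / s ^ n"
    have "sqrt s < d" using s d(1) by (simp add: real_less_lsqrt)
    have k0: "?k y = 0" if "norm (y - x) > sqrt s" for y
      using kern_vanish[OF norm_square_div_ge_1[OF s(1) that]] by simp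
    have contk: "continuous_on UNIV ?k"
      using s(1) by (intro continuous_intros cont_kern) auto
    have i2: "integrable lborel ?k"
      by (rule integrable_vanishing_outside_cball[OF contk k0])
    have i1: "integrable lborel (\<lambda>y. u y * ?k y)"
      by (rule integrable_vanishing_outside_cball[of _ "sqrt s" x])
        (auto intro!: continuous_on_mult cont_u contk simp: k0 simp del: times_divide_eq_right)
    have "W x s = (\<integral>y. u y * ?k y \<partial>lborel)" by (simp add: W_def)
    moreover have "2 * gamma_n n * u x = (\<integral>y. u x * ?k y \<partial>lborel)"
      unfolding integral_mult_right_zero integral_kern_scaled[OF s(1)] by simp
    ultimately have "W x s - 2 * gamma_n n * u x = (\<integral>y. (u y - u x) * ?k y \<partial>lborel)"
      using Bochner_Integration.integral_diff[OF i1 integrable_mult_right[OF i2, of "u x"]]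
      by (simp only: left_diff_distrib)
    also have "\<bar>\<dots>\<bar> \<le> (e' * (M / s ^ n)) * (V * sqrt s ^ DIM('a))"
      unfolding V_def
    proof (rule integral_vanishing_outside_cball_bound[of _ "sqrt s" x])
      show "continuous_on UNIV (\<lambda>y. (u y - u x) * ?k y)"
        using s(1) by (intro continuous_intros cont_u cont_kern) auto
      show "(u y - u x) * ?k y = 0" if "sqrt s < norm (y - x)" for y
        using norm_square_div_ge_1[OF s(1) that] kern_vanish by simp
      show "\<bar>(u y - u x) * ?k y\<bar> \<le> e' * (M / s ^ n)" if "norm (y - x) \<le> sqrt s" for y
      proof -
        have "\<bar>u y - u x\<bar> * \<bar>?k y\<bar> \<le> e' * (M / s ^ n)"
          using d(2)[of y] M(2)[of "(norm (y - x))\<^sup>2 / s"] that \<open>sqrt s < d\<close> s(1) e'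
          by (intro mult_mono) (auto simp: divide_right_mono)
        then show ?thesis by (simp only: abs_mult)
      qed
    qed (use s in simp)
    also have "\<dots> = e / 2"
      using s(1) M(1) V by (simp add: e'_def dim power_mult)
    finally show ?thesis using e by (simp add: dist_real_def)
  qed
  then show "\<forall>\<^sub>F s in at_right 0. dist (W x s) (2 * gamma_n n * u x) < e"
    using d(1) by (auto simp: eventually_at_right_field intro!: exI[of _ "d\<^sup>2"])
qed

end

text \<open>Serves in place of integrating \<open>W'\<close> over \<open>[a, b]\<close>: the
  derivative is compared with that of an explicit antiderivative \<open>\<Phi>\<close>, and
  \<open>\<Phi> - w\<close> is monotone.\<close>

lemma DERIV_le_imp_diff_le:
  fixes w \<Phi> :: "real \<Rightarrow> real"
  assumes "a \<le> b"
    and "\<And>s. a \<le> s \<Longrightarrow> s \<le> b \<Longrightarrow> (w has_real_derivative w' s) (at s)"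
    and "\<And>s. a \<le> s \<Longrightarrow> s \<le> b \<Longrightarrow> (\<Phi> has_real_derivative \<phi> s) (at s)"
    and "\<And>s. a \<le> s \<Longrightarrow> s \<le> b \<Longrightarrow> w' s \<le> \<phi> s"
  shows "w b - w a \<le> \<Phi> b - \<Phi> a"
proof -
  have "\<Phi> a - w a \<le> \<Phi> b - w b"
    by (rule DERIV_nonneg_imp_nondecreasing[OF assms(1)])
      (metis DERIV_diff assms(2-4) diff_ge_0_iff_ge)
  then show ?thesis by simp
qed

lemma integral_outside_large_ball_small:
  fixes f :: "'a::euclidean_space \<Rightarrow> real"
  assumes int: "integrable lborel f" and e: "e > 0"
  obtains \<rho> where "(\<integral>y. \<bar>f y\<bar> * indicator {y. norm y \<ge> \<rho>} y \<partial>lborel) < e"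
proof -
  have [measurable]: "f \<in> borel_measurable borel" using int by auto
  have "((\<lambda>\<rho>. \<integral>y. \<bar>f y\<bar> * indicator {y. norm y \<ge> \<rho>} y \<partial>lborel) \<longlongrightarrow> integral\<^sup>L lborel (\<lambda>y::'a. 0::real)) at_top"
  proof (rule integral_dominated_convergence_at_top[where w = "\<lambda>y. \<bar>f y\<bar>" and f = "\<lambda>_. 0"
        and s = "\<lambda>\<rho> y. \<bar>f y\<bar> * indicator {y. norm y \<ge> \<rho>} y"])
    show "integrable lborel (\<lambda>y. \<bar>f y\<bar>)" using int by (rule integrable_abs)
    show "AE y in lborel. ((\<lambda>\<rho>. \<bar>f y\<bar> * indicator {y. norm y \<ge> \<rho>} y) \<longlongrightarrow> 0) at_top"
    proof (rule AE_I2)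
      fix y :: 'a
      show "((\<lambda>\<rho>. \<bar>f y\<bar> * indicator {y. norm y \<ge> \<rho>} y) \<longlongrightarrow> 0) at_top"
        by (rule tendsto_eventually[OF eventually_mono[OF eventually_gt_at_top[of "norm y"]]]) simp
    qed
    show "\<forall>\<^sub>F \<rho> in at_top. AE y in lborel. norm (\<bar>f y\<bar> * indicator {y. norm y \<ge> \<rho>} y) \<le> \<bar>f y\<bar>"
      by (simp add: indicator_def)
  qed measurable
  then have "\<forall>\<^sub>F \<rho> in at_top. (\<integral>y. \<bar>f y\<bar> * indicator {y. norm y \<ge> \<rho>} y \<partial>lborel) < e"
    using e by (intro order_tendstoD) simp_all
  then show ?thesis using that by (auto simp: eventually_at_top_linorder)
qed

section \<open>Size, translation and limit of the localized mass \<open>F\<close>\<close>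

context radial_means
begin

lemma f_measurable [measurable]: "f \<in> borel_measurable borel"
  by (rule borel_measurable_continuous_onI[OF cont_f])

lemma f_bump_integrable:
  assumes "s > 0"
  shows "integrable lborel (\<lambda>y. f y * bump ((norm (y - x))\<^sup>2 / s))"
  by (rule integrable_vanishing_outside_cball[of _ "sqrt s" x])
    (use assms norm_square_div_ge_1[OF assms] in \<open>auto intro!: continuous_on_mult cont_f cont_bump bump_eq_0
        simp del: le_divide_eq_1_pos\<close>)

lemma f_cball_integrable: "integrable lborel (\<lambda>y. \<bar>f y\<bar> * indicator (cball x r) y)"
  using borel_integrable_compact[OF compact_cball, of x r "\<lambda>y. \<bar>f y\<bar>"] cont_f
  by (simp add: mult.commute continuous_on_rabs continuous_on_subset)

lemma F_abs_le:
  assumes s: "s > 0"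
  shows "\<bar>F x s\<bar> \<le> (\<integral>y. \<bar>f y\<bar> * indicator (cball x (sqrt s)) y \<partial>lborel)"
proof -
  have "norm (F x s) \<le> (\<integral>y. \<bar>f y\<bar> * indicator (cball x (sqrt s)) y \<partial>lborel)"
    unfolding F_def
  proof (rule Bochner_Integration.integral_norm_bound_integral[OF f_bump_integrable[OF s] f_cball_integrable])
    fix y
    show "norm (f y * bump ((norm (y - x))\<^sup>2 / s)) \<le> \<bar>f y\<bar> * indicator (cball x (sqrt s)) y"
    proof (cases "norm (y - x) \<le> sqrt s")
      case True
      then show ?thesis using s
        by (auto simp: abs_mult dist_norm norm_minus_commute bump_nonneg bump_le_1 intro!: mult_left_le)
    next
      case False
      then show ?thesis using bump_eq_0[OF norm_square_div_ge_1[OF s, of y x]] by simp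
    qed
  qed
  then show ?thesis by simp
qed

text \<open>For small scales: since \<open>n \<ge> 1\<close>, it keeps \<open>F x s / s\<close>
  bounded as \<open>s\<close> tends to 0.\<close>

lemma F_abs_le_power:
  assumes "s > 0" and "\<And>y. norm (y - x) \<le> sqrt s \<Longrightarrow> \<bar>f y\<bar> \<le> B"
  shows "\<bar>F x s\<bar> \<le> B * unit_ball_vol (real (2 * n)) * s ^ n"
proof -
  have "\<bar>F x s\<bar> \<le> B * (unit_ball_vol DIM('a) * sqrt s ^ DIM('a))"
    unfolding F_def
  proof (rule integral_vanishing_outside_cball_bound[of _ "sqrt s" x])
    show "continuous_on UNIV (\<lambda>y. f y * bump ((norm (y - x))\<^sup>2 / s))"
      using assms(1) by (intro continuous_on_mult cont_f cont_bump)
    show "f y * bump ((norm (y - x))\<^sup>2 / s) = 0" if "sqrt s < norm (y - x)" for y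
      using bump_eq_0[OF norm_square_div_ge_1[OF assms(1) that]] by simp
    show "\<bar>f y * bump ((norm (y - x))\<^sup>2 / s)\<bar> \<le> B" if "norm (y - x) \<le> sqrt s" for y
    proof -
      have "\<bar>f y\<bar> * bump ((norm (y - x))\<^sup>2 / s) \<le> \<bar>f y\<bar>"
        using assms(1) by (intro mult_left_le bump_le_1) auto
      with assms(2)[OF that] show ?thesis by (simp add: abs_mult bump_nonneg)
    qed
  qed (use assms in simp)
  then show ?thesis using assms(1) dim by (simp add: power_mult)
qed

lemma F_le_L1:
  assumes "integrable lborel f" and s: "s > 0"
  shows "\<bar>F x s\<bar> \<le> (\<integral>y. \<bar>f y\<bar> \<partial>lborel)"
proof -
  have "(\<integral>y. \<bar>f y\<bar> * indicator (cball x (sqrt s)) y \<partial>lborel) \<le> (\<integral>y. \<bar>f y\<bar> \<partial>lborel)"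
    by (rule integral_mono[OF f_cball_integrable]) (use assms(1) in \<open>auto simp: indicator_def\<close>)
  with F_abs_le[OF s, of x] show ?thesis by linarith
qed

lemma radial_diff_le:
  assumes "\<And>r r'. \<bar>g (r\<^sup>2) - g (r'\<^sup>2)\<bar> \<le> L * \<bar>r - r'\<bar>" and "L > 0" and s: "s > 0"
  shows "\<bar>g ((norm (y - x))\<^sup>2 / s) - g ((norm y)\<^sup>2 / s)\<bar> \<le> L * (norm x / sqrt s)"
proof -
  have "\<bar>g ((norm (y - x) / sqrt s)\<^sup>2) - g ((norm y / sqrt s)\<^sup>2)\<bar>
      \<le> L * \<bar>norm (y - x) / sqrt s - norm y / sqrt s\<bar>"
    by (rule assms(1))
  also have "\<bar>norm (y - x) / sqrt s - norm y / sqrt s\<bar> = \<bar>norm (y - x) - norm y\<bar> / sqrt s"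
    using s by (simp flip: diff_divide_distrib)
  also have "L * (\<bar>norm (y - x) - norm y\<bar> / sqrt s) \<le> L * (norm x / sqrt s)"
    using norm_triangle_ineq3[of "y - x" y] assms(2) s by (intro mult_left_mono divide_right_mono) auto
  finally show ?thesis using s by (simp add: power_divide)
qed

text \<open>Moving the centre from 0 to \<open>x\<close> moves the rescaled radius by at most
  \<open>|x| / sqrt s\<close>. After division by \<open>s\<close> the bound decays like
  \<open>s^(-3/2)\<close>, which is integrable at infinity.\<close>

lemma F_diff_bound:
  assumes int: "integrable lborel f"
  obtains L where "L > 0"
    and "\<And>x s. s > 0 \<Longrightarrow> \<bar>F x s - F 0 s\<bar> \<le> L * (norm x / sqrt s) * (\<integral>y. \<bar>f y\<bar> \<partial>lborel)"
proof -
  obtain L where L: "L > 0" "\<And>r r'. \<bar>bump (r\<^sup>2) - bump (r'\<^sup>2)\<bar> \<le> L * \<bar>r - r'\<bar>"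
    using radial_lipschitz[OF smooth1_bump bump_eq_0] by blast
  have "\<bar>F x s - F 0 s\<bar> \<le> L * (norm x / sqrt s) * (\<integral>y. \<bar>f y\<bar> \<partial>lborel)" if s: "s > 0" for x s
  proof -
    note i = f_bump_integrable[OF s]
    have "F x s - F 0 s = (\<integral>y. f y * bump ((norm (y - x))\<^sup>2 / s) - f y * bump ((norm (y - 0))\<^sup>2 / s) \<partial>lborel)"
      unfolding F_def by (rule Bochner_Integration.integral_diff[OF i i, symmetric])
    also have "norm \<dots> \<le> (\<integral>y. L * (norm x / sqrt s) * \<bar>f y\<bar> \<partial>lborel)"
    proof (rule Bochner_Integration.integral_norm_bound_integral)
      fix y
      have "\<bar>f y\<bar> * \<bar>bump ((norm (y - x))\<^sup>2 / s) - bump ((norm y)\<^sup>2 / s)\<bar>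
          \<le> \<bar>f y\<bar> * (L * (norm x / sqrt s))"
        by (rule mult_left_mono[OF radial_diff_le[OF L(2,1) s]]) simp
      then show "norm (f y * bump ((norm (y - x))\<^sup>2 / s) - f y * bump ((norm (y - 0))\<^sup>2 / s))
          \<le> L * (norm x / sqrt s) * \<bar>f y\<bar>"
        by (simp only: right_diff_distrib[symmetric] abs_mult real_norm_def diff_zero mult.commute)
    qed (intro Bochner_Integration.integrable_diff integrable_mult_right integrable_abs i int)+
    finally show ?thesis by simp
  qed
  with L(1) that show ?thesis by blast
qed

text \<open>Dominated convergence with majorant \<open>|f|\<close>: the rescaled bump tends
  pointwise to \<open>bump 0 = 1\<close>.\<close>

lemma F_tendsto_integral:
  assumes int: "integrable lborel f"
  shows "(F 0 \<longlongrightarrow> (\<integral>y. f y \<partial>lborel)) at_top"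
  unfolding F_def
proof (rule integral_dominated_convergence_at_top[where w = "\<lambda>y. \<bar>f y\<bar>" and f = f
      and s = "\<lambda>s (y :: 'a). f y * bump ((norm (y - 0))\<^sup>2 / s)"])
  have [measurable]: "bump \<in> borel_measurable borel"
    by (rule borel_measurable_continuous_onI[OF smooth1_continuous[OF smooth1_bump]])
  show "(\<lambda>y. f y * bump ((norm (y - 0))\<^sup>2 / s)) \<in> borel_measurable lborel" for s
    by measurable
  show "\<forall>\<^sub>F s in at_top. AE y in lborel. norm (f y * bump ((norm (y - 0))\<^sup>2 / s)) \<le> \<bar>f y\<bar>"
  proof (rule eventually_mono[OF eventually_gt_at_top[of 0]], rule AE_I2)
    fix s :: real and y :: 'a assume "s > 0"
    then have "\<bar>f y\<bar> * bump ((norm (y - 0))\<^sup>2 / s) \<le> \<bar>f y\<bar>"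
      by (intro mult_left_le bump_le_1) auto
    then show "norm (f y * bump ((norm (y - 0))\<^sup>2 / s)) \<le> \<bar>f y\<bar>"
      by (simp add: abs_mult bump_nonneg)
  qed
  show "AE y in lborel. ((\<lambda>s. f y * bump ((norm (y - 0))\<^sup>2 / s)) \<longlongrightarrow> f y) at_top"
  proof (rule AE_I2)
    fix y :: 'a
    have "((\<lambda>s. (norm (y - 0))\<^sup>2 / s) \<longlongrightarrow> 0) at_top" by real_asymp
    then have "((\<lambda>s. bump ((norm (y - 0))\<^sup>2 / s)) \<longlongrightarrow> bump 0) at_top"
      using smooth1_continuous[OF smooth1_bump, of UNIV]
      by (intro continuous_on_tendsto_compose[of UNIV bump]) auto
    from tendsto_mult_left[OF this, of "f y"] show "((\<lambda>s. f y * bump ((norm (y - 0))\<^sup>2 / s)) \<longlongrightarrow> f y) at_top"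
      by (simp only: bump_0 mult_1_right)
  qed
  show "integrable lborel (\<lambda>y. \<bar>f y\<bar>)" using int by (rule integrable_abs)
qed measurable

end

section \<open>Means of a function of logarithmic growth\<close>

locale log_radial_means = radial_means +
  fixes A :: real
  assumes A: "A > 0" and growth: "\<And>y. \<bar>u y\<bar> \<le> A * (1 + ln (1 + norm y))"
begin

text \<open>The bound \<open>M / s^n\<close> on the kernel cancels the volume \<open>V s^n\<close>
  of its support, leaving the supremum of \<open>|u|\<close> on the ball.\<close>

lemma W_0_bound:
  obtains C where "C > 0" and "\<And>s. s > 0 \<Longrightarrow> \<bar>W 0 s\<bar> \<le> C * (1 + ln (1 + sqrt s))"
proof -
  obtain M where M: "M > 0" "\<And>t. t \<ge> 0 \<Longrightarrow> \<bar>kern n t\<bar> \<le> M"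
    using smooth1_bounded[OF smooth1_kern kern_vanish] by blast
  define V where "V = unit_ball_vol (real DIM('a))"
  have V: "V > 0" by (simp add: V_def)
  have "\<bar>W 0 s\<bar> \<le> A * M * V * (1 + ln (1 + sqrt s))" if s: "s > 0" for s
  proof -
    have "\<bar>W 0 s\<bar> \<le> (A * (1 + ln (1 + sqrt s)) * (M / s ^ n)) * (V * sqrt s ^ DIM('a))"
      unfolding W_def V_def
    proof (rule integral_vanishing_outside_cball_bound[of _ "sqrt s" 0])
      show "continuous_on UNIV (\<lambda>y. u y * kern n ((norm (y - 0))\<^sup>2 / s) / s ^ n)"
        using s by (intro continuous_intros cont_u cont_kern) auto
      show "u y * kern n ((norm (y - 0))\<^sup>2 / s) / s ^ n = 0" if "sqrt s < norm (y - 0)" for y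
        using kern_vanish[OF norm_square_div_ge_1[OF s that]] by simp
      show "\<bar>u y * kern n ((norm (y - 0))\<^sup>2 / s) / s ^ n\<bar> \<le> A * (1 + ln (1 + sqrt s)) * (M / s ^ n)"
        if "norm (y - 0) \<le> sqrt s" for y
      proof -
        have "ln (1 + norm y) \<le> ln (1 + sqrt s)"
          using that s by (subst ln_le_cancel_iff) (auto intro!: add_pos_nonneg)
        then have "\<bar>u y\<bar> \<le> A * (1 + ln (1 + sqrt s))"
          using growth[of y] A by (smt (verit) mult_left_mono)
        then have "\<bar>u y\<bar> * (\<bar>kern n ((norm (y - 0))\<^sup>2 / s)\<bar> / s ^ n) \<le> A * (1 + ln (1 + sqrt s)) * (M / s ^ n)"
          using M(2)[of "(norm (y - 0))\<^sup>2 / s"] s A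
          by (intro mult_mono divide_right_mono) (auto simp: add_nonneg_nonneg)
        then show ?thesis using s by (simp add: abs_mult)
      qed
    qed (use s in simp)
    also have "\<dots> = A * M * V * (1 + ln (1 + sqrt s))"
      using s dim by (simp add: power_mult)
    finally show ?thesis .
  qed
  moreover have "A * M * V > 0" using A M V by simp
  ultimately show ?thesis using that by blast
qed

text \<open>The Lipschitz property of the kernel gains a factor \<open>|x| / sqrt s\<close>, which
  beats the logarithmic growth of \<open>u\<close>.\<close>

lemma W_diff_tendsto_0: "((\<lambda>s. W x s - W 0 s) \<longlongrightarrow> 0) at_top"
proof -
  obtain L where L: "L > 0" "\<And>r r'. \<bar>kern n (r\<^sup>2) - kern n (r'\<^sup>2)\<bar> \<le> L * \<bar>r - r'\<bar>"
    using radial_lipschitz[OF smooth1_kern kern_vanish] by blast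
  define V where "V = unit_ball_vol (real DIM('a))"
  define D where "D = A * L * norm x * V * 4 ^ n"
  have bound: "\<bar>W x s - W 0 s\<bar> \<le> D * ((1 + ln (1 + 2 * sqrt s)) / sqrt s)"
    if s: "s > (norm x)\<^sup>2" for s
  proof -
    have s0: "s > 0" using s by (smt (verit) zero_le_power2)
    have xs: "norm x \<le> sqrt s" using s by (simp add: real_le_rsqrt)
    have i: "integrable lborel (\<lambda>y. u y * kern n ((norm (y - x))\<^sup>2 / s) / s ^ n)" for x
    proof (rule integrable_vanishing_outside_cball[of _ "sqrt s" x])
      show "continuous_on UNIV (\<lambda>y. u y * kern n ((norm (y - x))\<^sup>2 / s) / s ^ n)"
        using s0 by (intro continuous_intros cont_u cont_kern) auto
      show "u y * kern n ((norm (y - x))\<^sup>2 / s) / s ^ n = 0" if "sqrt s < norm (y - x)" for y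
        using kern_vanish[OF norm_square_div_ge_1[OF s0 that]] by simp
    qed
    let ?d = "\<lambda>y. u y * kern n ((norm (y - x))\<^sup>2 / s) / s ^ n - u y * kern n ((norm (y - 0))\<^sup>2 / s) / s ^ n"
    have "W x s - W 0 s = (\<integral>y. ?d y \<partial>lborel)"
      unfolding W_def by (rule Bochner_Integration.integral_diff[OF i i, symmetric])
    also have "\<bar>\<dots>\<bar> \<le> (A * (1 + ln (1 + 2 * sqrt s)) * (L * (norm x / sqrt s) / s ^ n)) * (V * (2 * sqrt s) ^ DIM('a))"
      unfolding V_def
    \<comment> \<open>Once \<open>|x| \<le> sqrt s\<close>, both kernels are supported in the ball
      of radius \<open>2 sqrt s\<close> about 0; the factor \<open>4^n\<close> in \<open>D\<close>
      comes from its volume.\<close>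
    proof (rule integral_vanishing_outside_cball_bound[of _ "2 * sqrt s" 0])
      show "continuous_on UNIV ?d"
        using s0 by (intro continuous_on_diff continuous_on_divide continuous_on_mult continuous_on_const
            cont_u cont_kern) auto
      show "?d y = 0" if "2 * sqrt s < norm (y - 0)" for y
      proof -
        have "sqrt s < norm (y - 0)" using that xs norm_ge_zero[of x] by linarith
        moreover have "sqrt s < norm (y - x)" using that xs norm_triangle_ineq2[of y x] by simp
        ultimately show ?thesis
          by (simp only: kern_vanish[OF norm_square_div_ge_1[OF s0]])
      qed
      show "\<bar>?d y\<bar> \<le> A * (1 + ln (1 + 2 * sqrt s)) * (L * (norm x / sqrt s) / s ^ n)"
        if "norm (y - 0) \<le> 2 * sqrt s" for y
      proof -
        have "ln (1 + norm y) \<le> ln (1 + 2 * sqrt s)"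
          using that s0 by (subst ln_le_cancel_iff) (auto intro!: add_pos_nonneg)
        then have "\<bar>u y\<bar> \<le> A * (1 + ln (1 + 2 * sqrt s))"
          using growth[of y] A by (smt (verit) mult_left_mono)
        then have "\<bar>u y\<bar> * (\<bar>kern n ((norm (y - x))\<^sup>2 / s) - kern n ((norm y)\<^sup>2 / s)\<bar> / s ^ n)
            \<le> A * (1 + ln (1 + 2 * sqrt s)) * (L * (norm x / sqrt s) / s ^ n)"
          using radial_diff_le[OF L(2,1) s0, of y x] s0 A
          by (intro mult_mono divide_right_mono) (auto simp: add_nonneg_nonneg)
        moreover have "?d y = u y * ((kern n ((norm (y - x))\<^sup>2 / s) - kern n ((norm y)\<^sup>2 / s)) / s ^ n)"
          by (simp add: right_diff_distrib diff_divide_distrib)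
        ultimately show ?thesis using s0 by (simp only: abs_mult abs_divide) simp
      qed
    qed (use s0 in simp)
    also have "\<dots> = D * ((1 + ln (1 + 2 * sqrt s)) / sqrt s)"
      using s0 dim by (simp add: D_def power_mult power_mult_distrib)
    finally show ?thesis .
  qed
  have lim: "((\<lambda>s. D * ((1 + ln (1 + 2 * sqrt s)) / sqrt s)) \<longlongrightarrow> 0) at_top"
    by real_asymp
  show ?thesis
    by (rule Lim_null_comparison[OF _ lim])
      (rule eventually_mono[OF eventually_gt_at_top[of "(norm x)\<^sup>2"]], simp only: real_norm_def bound)
qed

end

subsection \<open>Integrability and the pointwise lower bound\<close>

context log_radial_means
begin

text \<open>If \<open>\<sigma> * F 0 s \<ge> c\<close> for large \<open>s\<close>, then
  \<open>\<sigma> * W 0 s\<close> falls at least like \<open>- c ln s\<close>, while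
  \<open>W_0_bound\<close> permits only \<open>(C / 2) ln s\<close> asymptotically. Hence
  \<open>c \<le> C / 2\<close>, which bounds the mass of \<open>|f|\<close> on balls independently
  of the radius.\<close>

lemma integrable_if_sign:
  assumes R: "R > 0" and sign: "(\<forall>y. norm y \<ge> R \<longrightarrow> f y \<ge> 0) \<or> (\<forall>y. norm y \<ge> R \<longrightarrow> f y \<le> 0)"
  shows "integrable lborel f"
proof -
  define \<sigma> :: real where "\<sigma> = (if \<forall>y. norm y \<ge> R \<longrightarrow> f y \<ge> 0 then 1 else - 1)"
  have \<sigma>: "\<sigma> = 1 \<or> \<sigma> = - 1" and \<sigma>f: "\<And>y. norm y \<ge> R \<Longrightarrow> \<sigma> * f y = \<bar>f y\<bar>"
    using sign by (auto simp: \<sigma>_def)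
  have abs\<sigma>: "\<bar>\<sigma>\<bar> = 1" using \<sigma> by auto
  define I where "I r = (\<integral>y. \<bar>f y\<bar> * indicator (cball 0 r) y \<partial>lborel)" for r
  obtain C where C: "C > 0" "\<And>s. s > 0 \<Longrightarrow> \<bar>W 0 s\<bar> \<le> C * (1 + ln (1 + sqrt s))"
    using W_0_bound by blast
  define B where "B = (C + 2 * I R) * exp 1"
  have bound: "I r \<le> B" if r: "r > 0" for r
  proof -
    \<comment> \<open>\<open>exp (- 1)\<close> is the lower bound of \<open>bump\<close> on
      \<open>[0, 1/2]\<close>, whence \<open>s \<ge> 2 r^2\<close> below. Inside radius
      \<open>R\<close> the sign is unknown, and \<open>2 |f|\<close> covers both the term
      \<open>exp (- 1) |f|\<close> and a possibly negative \<open>\<sigma> f\<close>.\<close>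
    define c where "c = exp (- 1) * I r - 2 * I R"
    have lower: "\<sigma> * F 0 s \<ge> c" if s: "s \<ge> 2 * r\<^sup>2" for s
    proof -
      have s0: "s > 0" using s r by (smt (verit) zero_less_power2)
      note i = f_cball_integrable
      have "c = (\<integral>y. exp (- 1) * (\<bar>f y\<bar> * indicator (cball 0 r) y)
          - 2 * (\<bar>f y\<bar> * indicator (cball 0 R) y) \<partial>lborel)"
        unfolding c_def I_def
        by (simp only: Bochner_Integration.integral_diff[OF integrable_mult_right[OF i] integrable_mult_right[OF i]]
            integral_mult_right_zero)
      also have "\<dots> \<le> (\<integral>y. \<sigma> * (f y * bump ((norm (y - 0))\<^sup>2 / s)) \<partial>lborel)"
      proof (rule integral_mono)
        fix y :: 'a
        let ?b = "bump ((norm (y - 0))\<^sup>2 / s)"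
        have b: "0 \<le> ?b" "?b \<le> 1" using s0 by (auto simp: bump_nonneg bump_le_1)
        have b2: "exp (- 1) * indicator (cball 0 r) y \<le> ?b"
        proof (cases "norm y \<le> r")
          case True
          then have "(norm y)\<^sup>2 \<le> r\<^sup>2" by (simp add: power_mono)
          then have "(norm (y - 0))\<^sup>2 / s \<le> 1 / 2" using s s0 by (simp add: divide_simps)
          with True s0 show ?thesis using bump_ge_half[of "(norm (y - 0))\<^sup>2 / s"] by simp
        qed (use b in simp)
        have "exp (- 1) * indicator (cball 0 r) y * \<bar>f y\<bar> - 2 * indicator (cball 0 R) y * \<bar>f y\<bar>
            \<le> (\<sigma> * f y) * ?b"
        proof (cases "norm y \<ge> R")
          case True
          have "exp (- 1) * indicator (cball 0 r) y * \<bar>f y\<bar> \<le> ?b * \<bar>f y\<bar>"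
            using b2 by (intro mult_right_mono) auto
          moreover have "2 * indicator (cball 0 R) y * \<bar>f y\<bar> \<ge> 0" by simp
          ultimately show ?thesis unfolding \<sigma>f[OF True] by (simp only: mult.commute[of "\<bar>f y\<bar>"])
        next
          case False
          have "exp (- 1) * indicator (cball 0 r) y * \<bar>f y\<bar> \<le> 1 * \<bar>f y\<bar>"
            using b2 b by (intro mult_right_mono) auto
          moreover have "\<bar>(\<sigma> * f y) * ?b\<bar> \<le> \<bar>f y\<bar>"
            using b abs\<sigma> by (simp add: abs_mult mult_left_le)
          ultimately show ?thesis using False by (simp add: indicator_def)
        qed
        then show "exp (- 1) * (\<bar>f y\<bar> * indicator (cball 0 r) y) - 2 * (\<bar>f y\<bar> * indicator (cball 0 R) y)
            \<le> \<sigma> * (f y * ?b)"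
          by (simp only: ac_simps)
      qed (intro Bochner_Integration.integrable_diff integrable_mult_right i f_bump_integrable s0)+
      also have "\<dots> = \<sigma> * F 0 s" unfolding F_def by (rule integral_mult_right_zero)
      finally show ?thesis .
    qed
    define a where "a = 2 * r\<^sup>2"
    have a: "a > 0" using r by (simp add: a_def)
    define D where "D = C * (1 + ln (1 + sqrt a)) + c * ln a"
    have step: "c \<le> C * (1 + ln (1 + sqrt b)) / ln b + D / ln b" if b: "b > max a 1" for b
    proof -
      have diff: "\<sigma> * W 0 b - \<sigma> * W 0 a \<le> - c * ln b - (- c * ln a)"
      proof (rule DERIV_le_imp_diff_le)
        fix s assume s: "a \<le> s" "s \<le> b"
        then have s0: "s > 0" using a by linarith
        show "((\<lambda>s. \<sigma> * W 0 s) has_real_derivative \<sigma> * (- F 0 s / s)) (at s)"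
          by (rule DERIV_cmult[OF W_DERIV[OF s0]])
        show "((\<lambda>s. - c * ln s) has_real_derivative - c * (1 / s)) (at s)"
          using DERIV_cmult[OF DERIV_ln_divide[OF s0]] .
        show "\<sigma> * (- F 0 s / s) \<le> - c * (1 / s)"
          using divide_right_mono[of c "\<sigma> * F 0 s" s] lower[of s] s s0 by (simp add: a_def)
      qed (use b in simp)
      have "\<bar>\<sigma> * W 0 b\<bar> \<le> C * (1 + ln (1 + sqrt b))" "\<bar>\<sigma> * W 0 a\<bar> \<le> C * (1 + ln (1 + sqrt a))"
        using C(2)[of b] C(2)[OF a] a b by (simp_all add: abs_mult abs\<sigma>)
      from diff abs_le_D2[OF this(1)] abs_le_D1[OF this(2)]
      have "c * ln b \<le> C * (1 + ln (1 + sqrt b)) + D"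
        unfolding D_def mult_minus_left by linarith
      moreover have "ln b > 0" using b by simp
      ultimately show ?thesis by (simp add: field_simps)
    qed
    \<comment> \<open>\<open>ln (1 + sqrt b) / ln b\<close> tends to 1/2.\<close>
    have "((\<lambda>b. C * (1 + ln (1 + sqrt b)) / ln b + D / ln b) \<longlongrightarrow> C / 2) at_top"
      by real_asymp
    moreover have "\<forall>\<^sub>F b in at_top. c \<le> C * (1 + ln (1 + sqrt b)) / ln b + D / ln b"
      by (rule eventually_mono[OF eventually_gt_at_top step])
    ultimately have "c \<le> C / 2"
      by (rule tendsto_lowerbound) simp
    then have "exp (- 1) * I r \<le> C + 2 * I R" using C(1) by (simp add: c_def)
    then have "exp 1 * (exp (- 1) * I r) \<le> exp 1 * (C + 2 * I R)" by (intro mult_left_mono) auto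
    moreover have "exp 1 * (exp (- 1) * I r) = I r" by (simp add: exp_minus)
    ultimately show ?thesis by (simp only: B_def mult.commute)
  qed
  have mono: "incseq (\<lambda>k. I (real k))"
    unfolding incseq_def I_def
  proof (intro allI impI integral_mono f_cball_integrable)
    fix m k :: nat and y :: 'a assume "m \<le> k"
    then show "\<bar>f y\<bar> * indicator (cball 0 (real m)) y \<le> \<bar>f y\<bar> * indicator (cball 0 (real k)) y"
      by (auto simp: indicator_def)
  qed
  \<comment> \<open>The bound \<open>B\<close> was shown for positive radii only, so
    \<open>k = 0\<close> is covered by \<open>I 0\<close>.\<close>
  have "I (real k) \<le> max B (I 0)" for k
    using bound[of "real k"] by (cases k) auto
  then obtain l where l: "(\<lambda>k. I (real k)) \<longlonglongrightarrow> l"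
    using incseq_convergent[OF mono] by blast
  have "integrable lborel (\<lambda>y. \<bar>f y\<bar>)"
  proof (rule integrable_monotone_convergence)
    show "integrable lborel (\<lambda>y. \<bar>f y\<bar> * indicator (cball 0 (real k)) y)" for k
      by (rule f_cball_integrable)
    show "AE y in lborel. mono (\<lambda>k. \<bar>f y\<bar> * indicator (cball 0 (real k)) y)"
      by (auto simp: mono_def indicator_def)
    show "AE y in lborel. (\<lambda>k. \<bar>f y\<bar> * indicator (cball 0 (real k)) y) \<longlonglongrightarrow> \<bar>f y\<bar>"
    proof (rule AE_I2)
      fix y :: 'a
      obtain N :: nat where N: "norm y \<le> real N" using real_arch_simple by blast
      have "\<forall>\<^sub>F k in sequentially. \<bar>f y\<bar> * indicator (cball 0 (real k)) y = \<bar>f y\<bar>"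
        by (rule eventually_sequentiallyI[of N]) (use N in auto)
      then show "(\<lambda>k. \<bar>f y\<bar> * indicator (cball 0 (real k)) y) \<longlonglongrightarrow> \<bar>f y\<bar>"
        by (rule tendsto_eventually)
    qed
    show "(\<lambda>k. \<integral>y. \<bar>f y\<bar> * indicator (cball 0 (real k)) y \<partial>lborel) \<longlonglongrightarrow> l"
      using l by (simp only: I_def)
    show "(\<lambda>y. \<bar>f y\<bar>) \<in> borel_measurable lborel" by measurable
  qed
  then show ?thesis by (rule integrable_abs_cancel) simp
qed

text \<open>For large \<open>r = |x|\<close> the scales are cut at \<open>s1 = r^(-p)\<close>,
  \<open>r^2 / 4\<close> and \<open>r^2\<close>, and the change of \<open>W x\<close> is bounded on
  each range. Beyond \<open>r^2\<close> the centre is switched to 0, where \<open>F 0 s\<close> is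
  close to \<open>\<Lambda>\<close>; this produces the main term
  \<open>2 \<Lambda> ln r\<close>.\<close>

lemma u_lower_bound:
  assumes int: "integrable lborel f"
    and poly: "B > 0" "\<And>y. \<bar>f y\<bar> \<le> B * (1 + norm y) ^ p"
    and e: "e > 0"
  defines "\<Lambda> \<equiv> \<integral>y. f y \<partial>lborel"
  obtains C where "\<And>x. 2 * gamma_n n * u x \<ge> - (2 * \<Lambda> + e) * ln (1 + norm x) - C"
proof -
  define N where "N = (\<integral>y. \<bar>f y\<bar> \<partial>lborel)"
  have N: "N \<ge> 0" by (simp add: N_def)
  define V where "V = unit_ball_vol (real (2 * n))"
  have V: "V > 0" by (simp add: V_def)
  \<comment> \<open>The error \<open>e1\<close> will be collected \<open>p + 2\<close> times
    \<open>ln r\<close> between \<open>s1\<close> and \<open>r^2 / 4\<close>, and twice more at the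
    centre 0.\<close>
  define e1 where "e1 = e / real (p + 4)"
  have e1: "e1 > 0" using e by (simp add: e1_def)
  obtain L where L: "L > 0" "\<And>x s. s > 0 \<Longrightarrow> \<bar>F x s - F 0 s\<bar> \<le> L * (norm x / sqrt s) * N"
    using F_diff_bound[OF int] unfolding N_def by blast
  obtain \<rho> where \<rho>: "(\<integral>y. \<bar>f y\<bar> * indicator {y. norm y \<ge> \<rho>} y \<partial>lborel) < e1"
    using integral_outside_large_ball_small[OF int e1] by blast
  have "\<forall>\<^sub>F s in at_top. F 0 s < \<Lambda> + e1"
    using F_tendsto_integral[OF int] e1 unfolding \<Lambda>_def by (intro order_tendstoD) auto
  then obtain s2' where "\<And>s. s \<ge> s2' \<Longrightarrow> F 0 s < \<Lambda> + e1"
    by (auto simp: eventually_at_top_linorder)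
  then obtain s2 where s2: "s2 \<ge> 1" "\<And>s. s \<ge> s2 \<Longrightarrow> F 0 s < \<Lambda> + e1"
    by (metis max.cobounded1 max.cobounded2 order_trans)
  \<comment> \<open>The bound 2 gives \<open>r + 2 \<le> 2 r\<close> and
    \<open>1 \<le> r^2 / 4\<close>; \<open>2 \<rho>\<close> keeps balls of radius
    \<open>r / 2\<close> about \<open>x\<close> away from the ball of radius \<open>\<rho>\<close>
    about 0; \<open>s2\<close> ensures \<open>s2 \<le> r^2\<close>.\<close>
  define R where "R = max (max 2 (2 * \<rho>)) s2"
  define K where "K = B * V * 2 ^ p"
  have K: "K > 0" using poly(1) V by (simp add: K_def)
  define C1 where "C1 = K + N * ln 4 + 2 * L * N + \<bar>W 0 s2\<bar> + \<bar>\<Lambda> + e1\<bar> * ln s2 + 2 * \<bar>\<Lambda>\<bar>"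
  have far: "2 * gamma_n n * u x \<ge> - (2 * \<Lambda> + e) * ln (1 + norm x) - C1" if x: "norm x \<ge> R" for x
  proof -
    define r where "r = norm x"
    have r: "r \<ge> 2" "r \<ge> 2 * \<rho>" "r \<ge> s2" using x by (auto simp: r_def R_def)
    define s1 where "s1 = 1 / r ^ p"
    have s1: "0 < s1" "s1 \<le> 1" using r by (auto simp: s1_def)
    have r4: "1 \<le> r\<^sup>2 / 4" using power_mono[of 2 r 2] r by simp
    \<comment> \<open>Smallest scales: \<open>f\<close> is at most \<open>B (2 r)^p\<close> near
      \<open>x\<close>, so \<open>W x\<close> has slope at most \<open>K r^p\<close>. The length
      \<open>s1 = r^(-p)\<close> makes the total change at most \<open>K\<close>.\<close>
    have i: "2 * gamma_n n * u x \<ge> W x s1 - K"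
    proof (rule tendsto_lowerbound[OF W_tendsto_at_right_0])
      have "W x s1 - K \<le> W x a" if a: "0 < a" "a < s1" for a
      proof -
        have "W x s1 - W x a \<le> K * r ^ p * s1 - K * r ^ p * a"
        proof (rule DERIV_le_imp_diff_le)
          fix s assume s: "a \<le> s" "s \<le> s1"
          then have s0: "0 < s" "s \<le> 1" using a s1 by auto
          show "(W x has_real_derivative - F x s / s) (at s)" by (rule W_DERIV[OF s0(1)])
          show "((\<lambda>s. K * r ^ p * s) has_real_derivative K * r ^ p) (at s)"
            by (auto intro!: derivative_eq_intros)
          have "\<bar>F x s\<bar> \<le> (B * (2 * r) ^ p) * V * s ^ n"
            unfolding V_def
          proof (rule F_abs_le_power[OF s0(1)])
            fix y assume "norm (y - x) \<le> sqrt s"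
            then have "norm y \<le> r + 1"
              using norm_triangle_sub[of y x] real_sqrt_le_1_iff[THEN iffD2, OF s0(2)] unfolding r_def by linarith
            then have "(1 + norm y) ^ p \<le> (2 * r) ^ p" using r by (intro power_mono) auto
            with poly show "\<bar>f y\<bar> \<le> B * (2 * r) ^ p"
              by (meson mult_left_mono order_trans less_imp_le)
          qed
          also have "\<dots> \<le> (B * (2 * r) ^ p) * V * s"
            using power_decreasing[OF n, of s] s0 poly(1) V r by (intro mult_left_mono) auto
          also have "\<dots> = K * r ^ p * s" by (simp add: K_def power_mult_distrib)
          finally show "- F x s / s \<le> K * r ^ p"
            unfolding pos_divide_le_eq[OF s0(1)] by linarith
        qed (use a in simp)
        moreover have "K * r ^ p * s1 = K" using r by (simp add: s1_def)
        moreover have "K * r ^ p * a \<ge> 0" using K r a by simp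
        ultimately show ?thesis by linarith
      qed
      then show "\<forall>\<^sub>F a in at_right 0. W x s1 - K \<le> W x a"
        using s1 by (auto simp: eventually_at_right_field)
    qed simp
    \<comment> \<open>Up to \<open>r^2 / 4\<close> the ball about \<open>x\<close> meets only the
      tail of \<open>f\<close>, whose mass is below \<open>e1\<close>.\<close>
    have "W x (r\<^sup>2 / 4) - W x s1 \<le> e1 * ln (r\<^sup>2 / 4) - e1 * ln s1"
    proof (rule DERIV_le_imp_diff_le)
      fix s assume s: "s1 \<le> s" "s \<le> r\<^sup>2 / 4"
      then have s0: "s > 0" using s1 by linarith
      show "(W x has_real_derivative - F x s / s) (at s)" by (rule W_DERIV[OF s0])
      show "((\<lambda>s. e1 * ln s) has_real_derivative e1 * (1 / s)) (at s)"
        using DERIV_cmult[OF DERIV_ln_divide[OF s0]] .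
      have sq: "sqrt s \<le> r / 2"
        using s(2) r by (intro real_le_lsqrt) (auto simp: power_divide)
      have "\<bar>F x s\<bar> \<le> (\<integral>y. \<bar>f y\<bar> * indicator (cball x (sqrt s)) y \<partial>lborel)"
        by (rule F_abs_le[OF s0])
      also have "\<dots> \<le> (\<integral>y. \<bar>f y\<bar> * indicator {y. norm y \<ge> \<rho>} y \<partial>lborel)"
      proof (rule integral_mono[OF f_cball_integrable])
        have "{y::'a. norm y \<ge> \<rho>} \<in> sets lborel" by measurable
        then show "integrable lborel (\<lambda>y. \<bar>f y\<bar> * indicator {y. norm y \<ge> \<rho>} y)"
          using integrable_real_mult_indicator[OF _ integrable_abs[OF int]] by blast
        fix y
        have "norm y \<ge> \<rho>" if "y \<in> cball x (sqrt s)"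
          using that sq r norm_triangle_ineq2[of x y] by (simp add: dist_norm r_def)
        then show "\<bar>f y\<bar> * indicator (cball x (sqrt s)) y \<le> \<bar>f y\<bar> * indicator {y. norm y \<ge> \<rho>} y"
          by (simp add: indicator_def)
      qed
      finally have "- F x s \<le> e1" using \<rho> by linarith
      then show "- F x s / s \<le> e1 * (1 / s)" using divide_right_mono[of "- F x s" e1 s] s0 by simp
    qed (use s1 r4 in linarith)
    moreover have "ln (r\<^sup>2 / 4) = 2 * ln r - ln 4" "ln s1 = - (real p * ln r)"
      using r by (simp_all add: s1_def ln_div ln_realpow)
    moreover have "e1 * ln 4 \<ge> 0" using e1 by simp
    ultimately have ii: "W x (r\<^sup>2 / 4) - W x s1 \<le> e1 * (2 * ln r) + e1 * (real p * ln r)"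
      by (simp add: right_diff_distrib)
    \<comment> \<open>On this range the crude bound by the full mass \<open>N\<close> suffices,
      since \<open>ln s\<close> varies only by \<open>ln 4\<close>.\<close>
    have "W x (r\<^sup>2) - W x (r\<^sup>2 / 4) \<le> N * ln (r\<^sup>2) - N * ln (r\<^sup>2 / 4)"
    proof (rule DERIV_le_imp_diff_le)
      fix s assume s: "r\<^sup>2 / 4 \<le> s" "s \<le> r\<^sup>2"
      then have s0: "s > 0" using r4 by linarith
      show "(W x has_real_derivative - F x s / s) (at s)" by (rule W_DERIV[OF s0])
      show "((\<lambda>s. N * ln s) has_real_derivative N * (1 / s)) (at s)"
        using DERIV_cmult[OF DERIV_ln_divide[OF s0]] .
      have "- F x s \<le> N" using F_le_L1[OF int s0, of x] by (simp add: N_def)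
      then show "- F x s / s \<le> N * (1 / s)" using divide_right_mono[of "- F x s" N s] s0 by simp
    qed simp
    moreover have "ln (r\<^sup>2 / 4) = ln (r\<^sup>2) - ln 4" using r by (simp add: ln_div)
    ultimately have iii: "W x (r\<^sup>2) - W x (r\<^sup>2 / 4) \<le> N * ln 4" by (simp add: right_diff_distrib)
    \<comment> \<open>From \<open>r^2\<close> to infinity the difference of the two means changes by
      at most the integral of \<open>L r N s^(-3/2)\<close>, which is \<open>2 L N\<close>, and it
      tends to 0.\<close>
    have iv: "W x (r\<^sup>2) - W 0 (r\<^sup>2) \<ge> - (2 * L * N)"
    proof -
      have "0 \<le> (W x (r\<^sup>2) - W 0 (r\<^sup>2)) + 2 * L * N"
      proof (rule tendsto_upperbound[OF W_diff_tendsto_0[of x]])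
        have "W x b - W 0 b \<le> (W x (r\<^sup>2) - W 0 (r\<^sup>2)) + 2 * L * N" if b: "b > r\<^sup>2" for b
        proof -
          have "(W x b - W 0 b) - (W x (r\<^sup>2) - W 0 (r\<^sup>2))
              \<le> - (2 * L * r * N) / sqrt b - (- (2 * L * r * N) / sqrt (r\<^sup>2))"
          proof (rule DERIV_le_imp_diff_le)
            fix s assume s: "r\<^sup>2 \<le> s" "s \<le> b"
            then have s0: "s > 0" using r4 by linarith
            show "((\<lambda>s. W x s - W 0 s) has_real_derivative - F x s / s - (- F 0 s / s)) (at s)"
              by (rule DERIV_diff[OF W_DERIV[OF s0] W_DERIV[OF s0]])
            show "((\<lambda>s. - (2 * L * r * N) / sqrt s) has_real_derivative L * (r / sqrt s) * N / s) (at s)"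
              using s0 by (auto intro!: derivative_eq_intros simp: field_simps)
            have "- F x s - (- F 0 s) \<le> L * (r / sqrt s) * N"
              using L(2)[OF s0, of x] by (simp add: r_def)
            then have "(- F x s - (- F 0 s)) / s \<le> L * (r / sqrt s) * N / s"
              using s0 by (intro divide_right_mono) auto
            then show "- F x s / s - (- F 0 s / s) \<le> L * (r / sqrt s) * N / s"
              by (simp add: diff_divide_distrib add_divide_distrib)
          qed (use b in simp)
          moreover have "b \<ge> 0" using b by (smt (verit) zero_le_power2)
          then have "2 * L * r * N / sqrt b \<ge> 0"
            using L(1) N r by (intro divide_nonneg_nonneg) auto
          moreover have "2 * L * r * N / sqrt (r\<^sup>2) = 2 * L * N" using r by simp
          ultimately show ?thesis by simp
        qed
        then show "\<forall>\<^sub>F b in at_top. W x b - W 0 b \<le> (W x (r\<^sup>2) - W 0 (r\<^sup>2)) + 2 * L * N"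
          by (rule eventually_mono[OF eventually_gt_at_top])
      qed simp
      then show ?thesis by linarith
    qed
    \<comment> \<open>At the centre 0, from the fixed scale \<open>s2\<close> on,
      \<open>F 0 s < \<Lambda> + e1\<close>.\<close>
    have v0: "- W 0 (r\<^sup>2) - (- W 0 s2) \<le> (\<Lambda> + e1) * ln (r\<^sup>2) - (\<Lambda> + e1) * ln s2"
    proof (rule DERIV_le_imp_diff_le)
      have "r * 1 \<le> r * r" using r by (intro mult_left_mono) auto
      then show "s2 \<le> r\<^sup>2" using r unfolding power2_eq_square by linarith
      fix s assume s: "s2 \<le> s" "s \<le> r\<^sup>2"
      then have s0: "s > 0" using s2 by linarith
      show "((\<lambda>s. - W 0 s) has_real_derivative - (- F 0 s / s)) (at s)"
        by (rule DERIV_minus[OF W_DERIV[OF s0]])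
      show "((\<lambda>s. (\<Lambda> + e1) * ln s) has_real_derivative (\<Lambda> + e1) * (1 / s)) (at s)"
        using DERIV_cmult[OF DERIV_ln_divide[OF s0]] .
      show "- (- F 0 s / s) \<le> (\<Lambda> + e1) * (1 / s)"
        using divide_right_mono[of "F 0 s" "\<Lambda> + e1" s] s2(2)[OF s(1)] s0 by simp
    qed
    have lnr2: "ln (r\<^sup>2) = 2 * ln r" using r by (simp add: ln_realpow)
    have "\<bar>(\<Lambda> + e1) * ln s2\<bar> = \<bar>\<Lambda> + e1\<bar> * ln s2" using s2 by (simp add: abs_mult)
    with v0[unfolded lnr2]
    have v: "W 0 (r\<^sup>2) \<ge> - \<bar>W 0 s2\<bar> - (\<Lambda> + e1) * (2 * ln r) - \<bar>\<Lambda> + e1\<bar> * ln s2"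
      by linarith
    have "e1 * (2 * ln r) + e1 * (real p * ln r) + e1 * (2 * ln r) = (e1 * real (p + 4)) * ln r"
      by (simp add: algebra_simps)
    also have "e1 * real (p + 4) = e" by (simp add: e1_def)
    finally have "e1 * (2 * ln r) + e1 * (real p * ln r) + e1 * (2 * ln r) = e * ln r" .
    with i ii iii iv v have main: "2 * gamma_n n * u x \<ge> - (2 * \<Lambda> * ln r) - e * ln r - (C1 - 2 * \<bar>\<Lambda>\<bar>)"
      unfolding C1_def distrib_right by linarith
    \<comment> \<open>Passing from \<open>ln r\<close> to \<open>ln (1 + r)\<close> costs at most
      \<open>2 |\<Lambda>|\<close>, because the logarithms differ by at most 1; this is the last
      term of \<open>C1\<close>.\<close>
    have lnr: "ln r \<le> ln (1 + r)" using r by simp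
    have "r * (1 + 1 / r) = 1 + r" using r by (simp add: field_simps)
    moreover have "ln (r * (1 + 1 / r)) = ln r + ln (1 + 1 / r)"
      using r by (intro ln_mult_pos) (auto intro!: add_pos_pos)
    ultimately have "ln (1 + r) = ln r + ln (1 + 1 / r)" by (simp only:)
    moreover have "ln (1 + 1 / r) \<le> 1 / r" using r by (intro ln_add_one_self_le_self) simp
    moreover have "1 / r \<le> 1" using r by simp
    ultimately have "ln (1 + r) - ln r \<le> 1" by linarith
    then have "\<bar>2 * \<Lambda> * (ln (1 + r) - ln r)\<bar> \<le> \<bar>2 * \<Lambda>\<bar> * 1"
      unfolding abs_mult using lnr by (intro mult_left_mono) auto
    moreover have "e * ln r \<le> e * ln (1 + r)" using e lnr by (intro mult_left_mono) auto
    ultimately have "2 * gamma_n n * u x \<ge> - (2 * \<Lambda> * ln (1 + r)) - e * ln (1 + r) - C1"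
      using main unfolding right_diff_distrib by linarith
    then show ?thesis unfolding r_def mult_minus_left distrib_right by linarith
  qed
  define l where "l = ln (1 + R)"
  define C2 where "C2 = \<bar>2 * gamma_n n\<bar> * (A * (1 + l)) + \<bar>2 * \<Lambda> + e\<bar> * l"
  have near: "2 * gamma_n n * u x \<ge> - (2 * \<Lambda> + e) * ln (1 + norm x) - C2" if x: "norm x \<le> R" for x
  proof -
    have l: "0 \<le> ln (1 + norm x)" "ln (1 + norm x) \<le> l"
      using x norm_ge_zero[of x] unfolding l_def
      by (simp, subst ln_le_cancel_iff) linarith+
    have "\<bar>u x\<bar> \<le> A * (1 + l)"
      using growth[of x] A l by (smt (verit) mult_left_mono)
    then have "\<bar>2 * gamma_n n * u x\<bar> \<le> \<bar>2 * gamma_n n\<bar> * (A * (1 + l))"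
      unfolding abs_mult[of "2 * gamma_n n"] by (intro mult_left_mono) auto
    moreover have "\<bar>(2 * \<Lambda> + e) * ln (1 + norm x)\<bar> \<le> \<bar>2 * \<Lambda> + e\<bar> * l"
      using l by (simp add: abs_mult mult_left_mono)
    ultimately show ?thesis unfolding C2_def minus_mult_left[symmetric] by linarith
  qed
  show ?thesis
  proof (rule that[of "max C1 C2"])
    show "2 * gamma_n n * u x \<ge> - (2 * \<Lambda> + e) * ln (1 + norm x) - max C1 C2" for x
      using far[of x] near[of x] by (cases "norm x \<ge> R") (auto simp: max_def)
  qed
qed

end

subsection \<open>Normal solutions\<close>

text \<open>Compactness handles a ball, the growth condition its outside. The comparison function
  \<open>1 + ln (1 + |x|)\<close> is at least 1 everywhere, which makes the bound global.\<close>

lemma log_growth_bound: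
  fixes u :: "'a::euclidean_space \<Rightarrow> real"
  assumes "continuous_on UNIV u" and "log_growth u"
  obtains A where "A > 0" and "\<And>x. \<bar>u x\<bar> \<le> A * (1 + ln (1 + norm x))"
proof -
  obtain c where "\<forall>\<^sub>F x in at_infinity. norm (u x) \<le> c * norm (ln (norm x))"
    using assms(2) unfolding log_growth_def by (auto elim: landau_o.bigE)
  then obtain b where b: "\<And>x. norm x \<ge> b \<Longrightarrow> \<bar>u x\<bar> \<le> c * \<bar>ln (norm x)\<bar>"
    by (auto simp: eventually_at_infinity)
  \<comment> \<open>Radius at least 1, so that \<open>ln (norm x)\<close> is nonnegative
    outside.\<close>
  obtain M where M: "M > 0" "\<And>x. norm x \<le> max b 1 \<Longrightarrow> \<bar>u x\<bar> \<le> M"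
    using compact_imp_bounded[OF compact_continuous_image[OF
        continuous_on_subset[OF assms(1) subset_UNIV] compact_cball[of 0 "max b 1"]]]
    unfolding bounded_pos real_norm_def
    by (metis imageI mem_cball_0)
  have "\<bar>u x\<bar> \<le> (\<bar>c\<bar> + M) * (1 + ln (1 + norm x))" for x
  proof (cases "norm x \<le> max b 1")
    case True
    have "M * 1 \<le> (\<bar>c\<bar> + M) * (1 + ln (1 + norm x))"
      using M(1) by (intro mult_mono) auto
    then show ?thesis using M(2)[OF True] by linarith
  next
    case False
    then have x: "norm x > b" "norm x > 1" by auto
    have "ln (norm x) \<le> ln (1 + norm x)"
      using x by (subst ln_le_cancel_iff) linarith+
    moreover have "0 \<le> ln (norm x)" using x by simp
    ultimately have "c * \<bar>ln (norm x)\<bar> \<le> (\<bar>c\<bar> + M) * (1 + ln (1 + norm x))"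
      using M(1) by (intro mult_mono) auto
    then show ?thesis using b[of x] x by linarith
  qed
  then show ?thesis using that[of "\<bar>c\<bar> + M"] M(1) by simp
qed

lemma gamma_n_pos: "n \<ge> 1 \<Longrightarrow> gamma_n n > 0"
  by (simp add: gamma_n_closed_form)

text \<open>The exponential turns the logarithmic bound on \<open>u\<close> into the power
  \<open>a = 2 n A\<close> of \<open>1 + |x|\<close>; \<open>p\<close> is a natural number above
  \<open>l + a\<close>.\<close>

lemma curvature_density_poly_bound:
  fixes K u :: "'a::euclidean_space \<Rightarrow> real"
  assumes "C > 0" and "l \<ge> 0" and K: "\<And>x. \<bar>K x\<bar> \<le> C * (norm x powr l + 1)"
    and A: "A > 0" and u: "\<And>x. \<bar>u x\<bar> \<le> A * (1 + ln (1 + norm x))"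
  obtains B p where "B > 0" and "\<And>x. \<bar>K x * exp (2 * real n * u x)\<bar> \<le> B * (1 + norm x) ^ p"
proof -
  define a where "a = 2 * real n * A"
  have a: "a \<ge> 0" using A by (simp add: a_def)
  obtain p :: nat where p: "l + a \<le> real p" using real_arch_simple by blast
  define B where "B = 2 * C * exp a"
  have "\<bar>K x * exp (2 * real n * u x)\<bar> \<le> B * (1 + norm x) ^ p" for x
  proof -
    let ?r = "1 + norm x"
    have r: "?r \<ge> 1" by simp
    have "norm x powr l \<le> ?r powr l" using assms(2) by (intro powr_mono2) auto
    moreover have "1 \<le> ?r powr l" using assms(2) by (intro ge_one_powr_ge_zero) auto
    ultimately have "C * (norm x powr l + 1) \<le> C * (2 * ?r powr l)"
      using assms(1) by (intro mult_left_mono) auto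
    with K[of x] have 1: "\<bar>K x\<bar> \<le> 2 * C * ?r powr l" by linarith
    have "2 * real n * u x \<le> 2 * real n * (A * (1 + ln ?r))"
      using u[of x] by (intro mult_left_mono) auto
    also have "\<dots> = a + a * ln ?r" by (simp add: a_def algebra_simps)
    finally have "exp (2 * real n * u x) \<le> exp a * ?r powr a"
      using norm_ge_zero[of x] by (auto simp: powr_def exp_add[symmetric] simp del: norm_ge_zero)
    with 1 have "\<bar>K x\<bar> * exp (2 * real n * u x) \<le> (2 * C * ?r powr l) * (exp a * ?r powr a)"
      using assms(1) by (intro mult_mono) auto
    also have "\<dots> = B * ?r powr (l + a)" by (simp add: B_def powr_add)
    also have "\<dots> \<le> B * ?r powr real p"
      using p assms(1) r by (intro mult_left_mono powr_mono) (auto simp: B_def)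
    also have "?r powr real p = ?r ^ p" by (rule powr_realpow) (simp add: add_pos_nonneg)
    finally show ?thesis by (simp add: abs_mult)
  qed
  moreover have "B > 0" using assms(1) by (simp add: B_def)
  ultimately show ?thesis using that by blast
qed

text \<open>The lower bound on \<open>u\<close> gives
  \<open>(1 + |x|)^(2n\<beta>) \<le> C exp(2nu)\<close> for
  \<open>\<beta> = - \<Lambda> / gamma_n n - e\<close>. So every such \<open>\<beta>\<close> is
  admissible in the supremum \<open>alpha1 n K\<close>.\<close>

lemma normal_solution_total_curvature:
  fixes K u :: "'a::euclidean_space \<Rightarrow> real"
  assumes n: "n \<ge> 1" and dim: "DIM('a) = 2 * n"
    and K: "continuous_on UNIV K" and sign: "constant_sign_at_infinity K"
    and K_bound: "\<exists>C>0. \<exists>l\<ge>0. \<forall>x. \<bar>K x\<bar> \<le> C * (norm x powr l + 1)"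
    and u: "normal_solution n K u"
  shows "integrable lborel (\<lambda>x. K x * exp (2 * real n * u x))"
    and "ereal (total_curvature n K u) \<ge> - alpha1 n K * ereal (gamma_n n)"
proof -
  define f where "f x = K x * exp (2 * real n * u x)" for x
  have cu: "continuous_on UNIV u" and lg: "log_growth u"
    and Q: "\<And>\<phi>. test_function \<phi> \<Longrightarrow>
      (\<integral>x. u x * (neg_laplacian ^^ n) \<phi> x \<partial>lborel) = (\<integral>x. f x * \<phi> x \<partial>lborel)"
    using u by (auto simp: normal_solution_def Q_solution_def f_def)
  obtain A where A: "A > 0" "\<And>x. \<bar>u x\<bar> \<le> A * (1 + ln (1 + norm x))"
    using log_growth_bound[OF cu lg] by blast
  interpret log_radial_means u f n A
  proof
    show "continuous_on UNIV f"
      unfolding f_def by (intro continuous_on_mult K continuous_on_exp continuous_on_const cu)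
  qed (use n dim cu Q A in auto)
  obtain R where R: "R > 0" "(\<forall>x. norm x \<ge> R \<longrightarrow> K x \<ge> 0) \<or> (\<forall>x. norm x \<ge> R \<longrightarrow> K x \<le> 0)"
    using sign by (auto simp: constant_sign_at_infinity_def)
  then have "(\<forall>x. norm x \<ge> R \<longrightarrow> f x \<ge> 0) \<or> (\<forall>x. norm x \<ge> R \<longrightarrow> f x \<le> 0)"
    by (simp add: f_def zero_le_mult_iff mult_le_0_iff)
  then have int: "integrable lborel f" by (rule integrable_if_sign[OF R(1)])
  then show "integrable lborel (\<lambda>x. K x * exp (2 * real n * u x))" by (simp add: f_def[abs_def])
  obtain C l where "C > 0" "l \<ge> 0" "\<And>x. \<bar>K x\<bar> \<le> C * (norm x powr l + 1)"
    using K_bound by metis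
  from curvature_density_poly_bound[OF this A growth, where n = n]
  obtain B p where B: "B > 0" "\<And>x. \<bar>f x\<bar> \<le> B * (1 + norm x) ^ p"
    unfolding f_def by metis
  define \<Lambda> where "\<Lambda> = (\<integral>x. f x \<partial>lborel)"
  define g where "g = gamma_n n"
  have g: "g > 0" using gamma_n_pos[OF n] by (simp add: g_def)
  have alpha: "ereal (- \<Lambda> / g - e) \<le> alpha1 n K" if e: "e > 0" for e
  proof -
    define \<beta> where "\<beta> = - \<Lambda> / g - e"
    \<comment> \<open>The tolerance \<open>2 * g * e\<close> becomes exactly \<open>e\<close> after
      division by \<open>2 * g\<close>.\<close>
    obtain C where C: "\<And>x. 2 * g * u x \<ge> - (2 * \<Lambda> + 2 * g * e) * ln (1 + norm x) - C"
      using u_lower_bound[OF int B, of "2 * g * e"] e g unfolding \<Lambda>_def g_def by auto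
    have "integrable lborel (\<lambda>x. K x * (1 + norm x) powr (2 * real n * \<beta>))"
    proof (rule Bochner_Integration.integrable_bound)
      show "integrable lborel (\<lambda>x. exp (real n * C / g) * f x)"
        using int by (rule integrable_mult_right)
      have [measurable]: "K \<in> borel_measurable borel" by (rule borel_measurable_continuous_onI[OF K])
      show "(\<lambda>x. K x * (1 + norm x) powr (2 * real n * \<beta>)) \<in> borel_measurable lborel" by measurable
      show "AE x in lborel. norm (K x * (1 + norm x) powr (2 * real n * \<beta>)) \<le> norm (exp (real n * C / g) * f x)"
      proof (rule AE_I2)
        fix x :: 'a
        have "2 * g * (\<beta> * ln (1 + norm x)) = - (2 * \<Lambda> + 2 * g * e) * ln (1 + norm x)"
          using g by (simp add: \<beta>_def field_simps)
        also have "\<dots> \<le> 2 * g * u x + C" using C[of x] by linarith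
        also have "\<dots> = 2 * g * (u x + C / (2 * g))" using g by (simp add: field_simps)
        finally have "\<beta> * ln (1 + norm x) \<le> u x + C / (2 * g)" using g by simp
        then have "2 * real n * (\<beta> * ln (1 + norm x)) \<le> 2 * real n * (u x + C / (2 * g))"
          by (intro mult_left_mono) auto
        also have "\<dots> = real n * C / g + 2 * real n * u x" using g by (simp add: field_simps)
        finally have "exp (2 * real n * (\<beta> * ln (1 + norm x))) \<le> exp (real n * C / g) * exp (2 * real n * u x)"
          by (simp add: exp_add[symmetric])
        moreover have "(1 + norm x) powr (2 * real n * \<beta>) = exp (2 * real n * (\<beta> * ln (1 + norm x)))"
          using norm_ge_zero[of x] by (auto simp: powr_def mult.assoc simp del: norm_ge_zero)
        ultimately have "\<bar>K x\<bar> * (1 + norm x) powr (2 * real n * \<beta>)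
            \<le> \<bar>K x\<bar> * (exp (real n * C / g) * exp (2 * real n * u x))"
          by (intro mult_left_mono) auto
        then show "norm (K x * (1 + norm x) powr (2 * real n * \<beta>)) \<le> norm (exp (real n * C / g) * f x)"
          by (simp add: f_def abs_mult mult_ac)
      qed
    qed
    then show ?thesis unfolding alpha1_def \<beta>_def[symmetric] by (intro Sup_upper) auto
  qed
  show "ereal (total_curvature n K u) \<ge> - alpha1 n K * ereal (gamma_n n)"
  \<comment> \<open>The value \<open>+\<infinity>\<close> makes the right-hand side
    \<open>-\<infinity>\<close>, as \<open>g > 0\<close>; the value \<open>-\<infinity>\<close>
    contradicts \<open>alpha\<close>.\<close>
  proof (cases "alpha1 n K")
    case (real a)
    have "- \<Lambda> / g \<le> a"
    proof (rule field_le_epsilon)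
      show "- \<Lambda> / g \<le> a + e" if "e > 0" for e
        using alpha[OF that] unfolding real by simp
    qed
    then have "- (a * g) \<le> \<Lambda>" using g by (simp add: field_simps)
    then show ?thesis
      unfolding real by (simp add: total_curvature_def \<Lambda>_def g_def f_def)
  next
    case PInf
    then show ?thesis using g by (simp add: g_def)
  next
    case MInf
    then show ?thesis using alpha[of 1] by simp
  qed
qed

lemma conformal_metric_inject:
  assumes "conformal_metric u = conformal_metric (v :: 'a::euclidean_space \<Rightarrow> real)"
  shows "u = v"
proof
  fix x
  obtain b :: 'a where "b \<in> Basis" using nonempty_Basis by blast
  then show "u x = v x"
    using fun_cong[OF fun_cong[OF fun_cong[OF assms, of x], of b], of b] by (simp add: conformal_metric_def)
qed

theorem corollary1p3:
  fixes n :: nat and K :: "real ^ 'd \<Rightarrow> real"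
  assumes "n \<ge> 1" and "CARD('d) = 2 * n"
    and "continuous_on UNIV K"
    and "\<exists>x. K x \<noteq> 0"
    and "constant_sign_at_infinity K"
    and "\<exists>C>0. \<exists>l\<ge>0. \<forall>x. \<bar>K x\<bar> \<le> C * (norm x powr l + 1)"
  shows "(\<forall>u. normal_solution n K u \<longrightarrow>
            integrable lborel (\<lambda>x. K x * exp (2 * real n * u x)) \<and>
            ereal (total_curvature n K u) \<ge> - alpha1 n K * ereal (gamma_n n))
       \<and> ((\<forall>x. K x \<le> 0) \<longrightarrow>
            ((\<exists>u. normal_solution n K u) \<longleftrightarrow>
               (\<exists>g. normal_conformal_metric g \<and> has_Q_curvature n g K)) \<and>
            ((\<exists>u. normal_solution n K u) \<longrightarrow> alpha1 n K \<ge> 0))"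
proof (intro conjI allI impI)
  have dim: "DIM(real ^ 'd) = 2 * n" using assms(2) by simp
  note main = normal_solution_total_curvature[OF assms(1) dim assms(3,5,6)]
  show "integrable lborel (\<lambda>x. K x * exp (2 * real n * u x))" if "normal_solution n K u" for u
    by (rule main(1)[OF that])
  show "ereal (total_curvature n K u) \<ge> - alpha1 n K * ereal (gamma_n n)" if "normal_solution n K u" for u
    by (rule main(2)[OF that])
  \<comment> \<open>Normality and curvature of \<open>g\<close> each come with their own conformal
    factor; \<open>conformal_metric_inject\<close> identifies the two.\<close>
  show "(\<exists>u. normal_solution n K u) \<longleftrightarrow> (\<exists>g. normal_conformal_metric g \<and> has_Q_curvature n g K)"
    unfolding normal_conformal_metric_def has_Q_curvature_def normal_solution_def
    by (auto simp: Q_solution_def dest: conformal_metric_inject)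
  assume K: "\<forall>x. K x \<le> 0" and "\<exists>u. normal_solution n K u"
  then obtain u where u: "normal_solution n K u" by blast
  have "total_curvature n K u \<le> 0"
    unfolding total_curvature_def
    using integral_nonneg_AE[of "\<lambda>x. - (K x * exp (2 * real n * u x))" lborel] K
    by (simp add: mult_nonpos_nonneg)
  then have "ereal (total_curvature n K u) \<le> 0" by simp
  with main(2)[OF u] have le: "- alpha1 n K * ereal (gamma_n n) \<le> 0"
    by (rule order_trans)
  show "alpha1 n K \<ge> 0"
  \<comment> \<open>Since \<open>gamma_n n > 0\<close>, a negative \<open>alpha1 n K\<close>, finite
    or not, would make the left side of \<open>le\<close> positive.\<close>
  proof (cases "alpha1 n K")
    case (real a)
    then show ?thesis using le gamma_n_pos[OF assms(1)] by (simp add: zero_le_mult_iff)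
  next
    case MInf
    then show ?thesis using le gamma_n_pos[OF assms(1)] by simp
  qed simp
qed

end
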